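(* Let $D$ be a nuclear positive-definite self-adjoint operator on $E$ whose eigenvectors are the basis vectors of $\mathcal E$. If the operator $D^{1/2}$ is nuclear, then the semigroup $\widehat{\mathcal U}_{tD}$, $t\ge0$, on $\mathcal H_{\mathcal E}$ is strongly continuous.
   Context: $E$ is an infinite-dimensional real separable Hilbert space with orthonormal basis $\mathcal E=\{e_k\}_{k\in\mathbb N}$; $x_k=(x,e_k)$. A block is a set $\Pi_{a,b}=\{x\in E: x_j\in[a_j,b_j)\ \forall j\}$ with $a,b\in\ell_\infty$, $a_j<b_j$; it is absolutely measurable if it is empty or $\sum_j\max\{0,\ln(b_j-a_j)\}<\infty$. Put $\lambda_{\mathcal E}(\Pi_{a,b})=\prod_j(b_j-a_j)$ if $\Pi_{a,b}\ne\emptyset$ (value $0$ if the product diverges to $0$), and $\lambda_{\mathcal E}(\emptyset)=0$. It is known that $\lambda_{\mathcal E}$ extends uniquely to a finitely additive shift-invariant measure on the ring generated by absolutely measurable blocks, and then to the completion $\mathcal R_{\mathcal E}$ of this ring. $\mathcal H_{\mathcal E}$ is the complex Hilbert space obtained by completing (modulo the null space) the space of finite sums $\sum c_k\chi_{B_k}$, $c_k\in\mathbb C$, $B_k\in\mathcal R_{\mathcal E}$ pairwise disjoint, in the norm $(\sum|c_k|^2\lambda_{\mathcal E}(B_k))^{1/2}$. $De_k=d_ke_k$. $\widehat{\mathcal U}_{tD}$ is the strong limit as $N\to\infty$ of the operators $\widehat{\mathcal U}_{tD_N}$ of multiplication by $\exp(-\frac t2\sum_{k\le N}d_kx_k^2)$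 on $\mathcal H_{\mathcal E}$. *)

theory Defs
  imports "HOL-Analysis.Analysis"
begin

section \<open>Operators on a real Hilbert space\<close>

definition orthonormal_basis :: "(nat \<Rightarrow> 'a::{real_inner,banach}) \<Rightarrow> bool" where
  "orthonormal_basis e \<longleftrightarrow>
     (\<forall>i j. e i \<bullet> e j = of_bool (i = j)) \<and> closure (span (range e)) = UNIV"

definition nuclear_operator :: "('a::{real_inner,banach} \<Rightarrow> 'a) \<Rightarrow> bool" where
  "nuclear_operator T \<longleftrightarrow>
     (\<exists>u v :: nat \<Rightarrow> 'a. summable (\<lambda>n. norm (u n) * norm (v n)) \<and>
        (\<forall>x. (\<lambda>n. (x \<bullet> u n) *\<^sub>R v n) sums T x))"

definition selfadjoint_operator :: "('a::{real_inner,banach} \<Rightarrow> 'a) \<Rightarrow> bool" where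
  "selfadjoint_operator T \<longleftrightarrow> bounded_linear T \<and> (\<forall>x y. T x \<bullet> y = x \<bullet> T y)"

definition positive_definite_operator :: "('a::{real_inner,banach} \<Rightarrow> 'a) \<Rightarrow> bool" where
  "positive_definite_operator T \<longleftrightarrow> (\<forall>x. x \<noteq> 0 \<longrightarrow> T x \<bullet> x > 0)"

definition sqrt_operator :: "('a::{real_inner,banach} \<Rightarrow> 'a) \<Rightarrow> ('a \<Rightarrow> 'a)" where
  "sqrt_operator T =
     (THE S. selfadjoint_operator S \<and> (\<forall>x. S x \<bullet> x \<ge> 0) \<and> (\<forall>x. S (S x) = T x))"


section \<open>The measure on the ring generated by absolutely measurable blocks\<close>

definition block :: "(nat \<Rightarrow> 'a::{real_inner,banach}) \<Rightarrow> (nat \<Rightarrow> real) \<Rightarrow> (nat \<Rightarrow> real) \<Rightarrow> 'a set" where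
  "block e a b = {x. \<forall>j. x \<bullet> e j \<in> {a j..<b j}}"

definition block_bounds :: "(nat \<Rightarrow> real) \<Rightarrow> (nat \<Rightarrow> real) \<Rightarrow> bool" where
  "block_bounds a b \<longleftrightarrow> bounded (range a) \<and> bounded (range b) \<and> (\<forall>j. a j < b j)"

definition abs_measurable_block ::
    "(nat \<Rightarrow> 'a::{real_inner,banach}) \<Rightarrow> (nat \<Rightarrow> real) \<Rightarrow> (nat \<Rightarrow> real) \<Rightarrow> bool" where
  "abs_measurable_block e a b \<longleftrightarrow> block_bounds a b \<and>
     (block e a b = {} \<or> summable (\<lambda>j. max 0 (ln (b j - a j))))"

text \<open>The value of an infinite product is the limit of its partial products, which exists for
  absolutely measurable nonempty blocks; \<^const>\<open>prodinf\<close> is unsuitable because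
  products that diverge to \<open>0\<close> must have the value \<open>0\<close>.\<close>

definition block_volume ::
    "(nat \<Rightarrow> 'a::{real_inner,banach}) \<Rightarrow> (nat \<Rightarrow> real) \<Rightarrow> (nat \<Rightarrow> real) \<Rightarrow> real" where
  "block_volume e a b =
     (if block e a b = {} then 0 else lim (\<lambda>n. \<Prod>j<n. b j - a j))"

definition block_ring :: "(nat \<Rightarrow> 'a::{real_inner,banach}) \<Rightarrow> 'a set set" where
  "block_ring e = ring_of_sets UNIV hull {block e a b |a b. abs_measurable_block e a b}"

text \<open>These properties determine \<open>\<mu>\<close> on \<open>block_ring e\<close> and leave it arbitrary elsewhere; its
  values off the ring are never used.\<close>

definition is_block_measure ::
    "(nat \<Rightarrow> 'a::{real_inner,banach}) \<Rightarrow> ('a set \<Rightarrow> real) \<Rightarrow> bool" where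
  "is_block_measure e \<mu> \<longleftrightarrow>
     (\<forall>A\<in>block_ring e. \<mu> A \<ge> 0) \<and>
     Measure_Space.additive (block_ring e) \<mu> \<and>
     (\<forall>A\<in>block_ring e. \<forall>h. \<mu> ((+) h ` A) = \<mu> A) \<and>
     (\<forall>a b. abs_measurable_block e a b \<longrightarrow> \<mu> (block e a b) = block_volume e a b)"

text \<open>The completion of a finitely additive measure on a ring (of Jordan type): the sets whose
  outer and inner measures, computed with sets of the ring, are finite and coincide.\<close>

definition outer_measure_on :: "'a set set \<Rightarrow> ('a set \<Rightarrow> real) \<Rightarrow> 'a set \<Rightarrow> real" where
  "outer_measure_on R \<mu> A = (INF C\<in>{C\<in>R. A \<subseteq> C}. \<mu> C)"

definition inner_measure_on :: "'a set set \<Rightarrow> ('a set \<Rightarrow> real) \<Rightarrow> 'a set \<Rightarrow> real" where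
  "inner_measure_on R \<mu> A = (SUP B\<in>{B\<in>R. B \<subseteq> A}. \<mu> B)"

definition completed_ring :: "'a set set \<Rightarrow> ('a set \<Rightarrow> real) \<Rightarrow> 'a set set" where
  "completed_ring R \<mu> =
     {A. (\<exists>C\<in>R. A \<subseteq> C) \<and> outer_measure_on R \<mu> A = inner_measure_on R \<mu> A}"


section \<open>The Hilbert space of a finitely additive measure\<close>

text \<open>Throughout, \<open>R\<close> is a ring of sets and \<open>\<mu>\<close> a finitely additive measure on it;
  simple functions are taken over the completion of \<open>R\<close>.\<close>

definition step_representation ::
    "'a set set \<Rightarrow> ('a set \<Rightarrow> real) \<Rightarrow> ('a \<Rightarrow> complex) \<Rightarrow> nat \<Rightarrow> (nat \<Rightarrow> complex) \<Rightarrow> (nat \<Rightarrow> 'a set) \<Rightarrow> bool" where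
  "step_representation R \<mu> f n c B \<longleftrightarrow>
     (\<forall>k<n. B k \<in> completed_ring R \<mu>) \<and> disjoint_family_on B {..<n} \<and>
     f = (\<lambda>x. \<Sum>k<n. c k * indicator (B k) x)"

definition step_functions :: "'a set set \<Rightarrow> ('a set \<Rightarrow> real) \<Rightarrow> ('a \<Rightarrow> complex) set" where
  "step_functions R \<mu> = {f. \<exists>n c B. step_representation R \<mu> f n c B}"

text \<open>On the completion the measure is the common value of the outer and inner measures.\<close>

definition step_norm :: "'a set set \<Rightarrow> ('a set \<Rightarrow> real) \<Rightarrow> ('a \<Rightarrow> complex) \<Rightarrow> real" where
  "step_norm R \<mu> f = (THE r. \<exists>n c B. step_representation R \<mu> f n c B \<and>
     r = sqrt (\<Sum>k<n. (cmod (c k))\<^sup>2 * outer_measure_on R \<mu> (B k)))"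

definition step_Cauchy :: "'a set set \<Rightarrow> ('a set \<Rightarrow> real) \<Rightarrow> (nat \<Rightarrow> 'a \<Rightarrow> complex) set" where
  "step_Cauchy R \<mu> = {s. (\<forall>n. s n \<in> step_functions R \<mu>) \<and>
     (\<forall>\<epsilon>>0. \<exists>M. \<forall>m\<ge>M. \<forall>n\<ge>M. step_norm R \<mu> (\<lambda>x. s m x - s n x) < \<epsilon>)}"

definition step_equiv ::
    "'a set set \<Rightarrow> ('a set \<Rightarrow> real) \<Rightarrow> ((nat \<Rightarrow> 'a \<Rightarrow> complex) \<times> (nat \<Rightarrow> 'a \<Rightarrow> complex)) set" where
  "step_equiv R \<mu> = {(s, r). s \<in> step_Cauchy R \<mu> \<and> r \<in> step_Cauchy R \<mu> \<and>
     (\<lambda>n. step_norm R \<mu> (\<lambda>x. s n x - r n x)) \<longlonglongrightarrow> 0}"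

text \<open>The completion depends on \<open>\<mu>\<close>, so it is a set and not a type: the elements are
  equivalence classes of Cauchy sequences, which also divides out the null space.\<close>

type_synonym 'a hvec = "(nat \<Rightarrow> 'a \<Rightarrow> complex) set"

definition H_space :: "'a set set \<Rightarrow> ('a set \<Rightarrow> real) \<Rightarrow> 'a hvec set" where
  "H_space R \<mu> = step_Cauchy R \<mu> // step_equiv R \<mu>"

definition H_add :: "'a set set \<Rightarrow> ('a set \<Rightarrow> real) \<Rightarrow> 'a hvec \<Rightarrow> 'a hvec \<Rightarrow> 'a hvec" where
  "H_add R \<mu> u v = (\<Union>s\<in>u. \<Union>r\<in>v. step_equiv R \<mu> `` {\<lambda>n x. s n x + r n x})"

definition H_scale :: "'a set set \<Rightarrow> ('a set \<Rightarrow> real) \<Rightarrow> complex \<Rightarrow> 'a hvec \<Rightarrow> 'a hvec" where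
  "H_scale R \<mu> c u = (\<Union>s\<in>u. step_equiv R \<mu> `` {\<lambda>n x. c * s n x})"

definition H_norm :: "'a set set \<Rightarrow> ('a set \<Rightarrow> real) \<Rightarrow> 'a hvec \<Rightarrow> real" where
  "H_norm R \<mu> u = (THE l. \<exists>s\<in>u. (\<lambda>n. step_norm R \<mu> (s n)) \<longlonglongrightarrow> l)"

definition H_dist :: "'a set set \<Rightarrow> ('a set \<Rightarrow> real) \<Rightarrow> 'a hvec \<Rightarrow> 'a hvec \<Rightarrow> real" where
  "H_dist R \<mu> u v = H_norm R \<mu> (H_add R \<mu> u (H_scale R \<mu> (- 1) v))"

definition H_bounded_linear :: "'a set set \<Rightarrow> ('a set \<Rightarrow> real) \<Rightarrow> ('a hvec \<Rightarrow> 'a hvec) \<Rightarrow> bool" where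
  "H_bounded_linear R \<mu> T \<longleftrightarrow>
     (\<forall>u\<in>H_space R \<mu>. T u \<in> H_space R \<mu>) \<and>
     (\<forall>u\<in>H_space R \<mu>. \<forall>v\<in>H_space R \<mu>. T (H_add R \<mu> u v) = H_add R \<mu> (T u) (T v)) \<and>
     (\<forall>c. \<forall>u\<in>H_space R \<mu>. T (H_scale R \<mu> c u) = H_scale R \<mu> c (T u)) \<and>
     (\<exists>K. \<forall>u\<in>H_space R \<mu>. H_norm R \<mu> (T u) \<le> K * H_norm R \<mu> u)"

text \<open>Multiplication by a bounded function \<open>f\<close>.  The product of \<open>f\<close> with a step function
  need not be a step function, only a limit of step functions.  So the product of \<open>f\<close> with the
  class of \<open>s\<close> is the class of a sequence \<open>r\<close> of step functions with \<open>f * s n - r n\<close> tending to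
  \<open>0\<close>, in the sense of being dominated pointwise by step functions whose norms tend to \<open>0\<close>.\<close>

definition H_mult :: "'a set set \<Rightarrow> ('a set \<Rightarrow> real) \<Rightarrow> ('a \<Rightarrow> complex) \<Rightarrow> 'a hvec \<Rightarrow> 'a hvec" where
  "H_mult R \<mu> f u = (THE v. v \<in> H_space R \<mu> \<and>
     (\<exists>s\<in>u. \<exists>r\<in>v. \<exists>g. (\<forall>n. g n \<in> step_functions R \<mu>) \<and>
        (\<forall>n x. cmod (f x * s n x - r n x) \<le> cmod (g n x)) \<and>
        (\<lambda>n. step_norm R \<mu> (g n)) \<longlonglongrightarrow> 0))"

definition H_strong_limit ::
    "'a set set \<Rightarrow> ('a set \<Rightarrow> real) \<Rightarrow> (nat \<Rightarrow> 'a hvec \<Rightarrow> 'a hvec) \<Rightarrow> ('a hvec \<Rightarrow> 'a hvec) \<Rightarrow> bool" where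
  "H_strong_limit R \<mu> T S \<longleftrightarrow>
     (\<forall>u\<in>H_space R \<mu>. S u \<in> H_space R \<mu> \<and> (\<lambda>N. H_dist R \<mu> (T N u) (S u)) \<longlonglongrightarrow> 0)"

definition H_strongly_continuous_semigroup ::
    "'a set set \<Rightarrow> ('a set \<Rightarrow> real) \<Rightarrow> (real \<Rightarrow> 'a hvec \<Rightarrow> 'a hvec) \<Rightarrow> bool" where
  "H_strongly_continuous_semigroup R \<mu> U \<longleftrightarrow>
     (\<forall>t\<ge>0. H_bounded_linear R \<mu> (U t)) \<and>
     (\<forall>u\<in>H_space R \<mu>. U 0 u = u) \<and>
     (\<forall>s\<ge>0. \<forall>t\<ge>0. \<forall>u\<in>H_space R \<mu>. U (s + t) u = U s (U t u)) \<and>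
     (\<forall>u\<in>H_space R \<mu>. \<forall>t\<ge>0. ((\<lambda>s. H_dist R \<mu> (U s u) (U t u)) \<longlongrightarrow> 0) (at t within {0..}))"


section \<open>The Gaussian multiplication operators\<close>

definition U_trunc :: "(nat \<Rightarrow> 'a::{real_inner,banach}) \<Rightarrow> ('a set \<Rightarrow> real) \<Rightarrow> (nat \<Rightarrow> real) \<Rightarrow>
    nat \<Rightarrow> real \<Rightarrow> 'a hvec \<Rightarrow> 'a hvec" where
  "U_trunc e \<mu> d N t =
     H_mult (block_ring e) \<mu>
       (\<lambda>x. complex_of_real (exp (- (t / 2) * (\<Sum>k\<le>N. d k * (x \<bullet> e k)\<^sup>2))))"

definition U_hat :: "(nat \<Rightarrow> 'a::{real_inner,banach}) \<Rightarrow> ('a set \<Rightarrow> real) \<Rightarrow> (nat \<Rightarrow> real) \<Rightarrow>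
    real \<Rightarrow> 'a hvec \<Rightarrow> 'a hvec" where
  "U_hat e \<mu> d t u = (THE v. v \<in> H_space (block_ring e) \<mu> \<and>
     (\<lambda>N. H_dist (block_ring e) \<mu> (U_trunc e \<mu> d N t u) v) \<longlonglongrightarrow> 0)"

end

theory Submission
  imports Defs
begin

text \<open>
  Every set of the ring generated by absolutely measurable blocks has uniformly bounded
  coordinates, and its intersection with a slab \<open>x\<^sub>k \<in> [p, q)\<close> is again in the ring.  Hence each
  factor \<open>exp (- t d\<^sub>k x\<^sub>k\<^sup>2 / 2)\<close> is, on every set of the ring, a uniform limit of step functions, and
  so are their finite products.  Nuclearity of \<open>D\<close> gives \<open>\<Sum> d\<^sub>k < \<infinity>\<close>, so the products converge
  uniformly on every set of the ring to \<open>exp (- t q / 2)\<close> with \<open>q x = \<Sum> d\<^sub>k x\<^sub>k\<^sup>2\<close> bounded there.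
  Multiplication by functions of modulus at most one is contractive on \<open>H\<close>, and step
  functions are supported in the ring; so uniform convergence on ring sets implies strong
  convergence of the multiplication operators, both in the truncation index and in \<open>t\<close>.
\<close>

section \<open>The Jordan completion of a content\<close>

text \<open>A finitely additive measure admits no dominated convergence, so pointwise convergence of
  the truncated exponentials says nothing about convergence in \<open>H\<close>; uniform convergence
  on ring sets takes its place. The obstacle is that a ring set may be unbounded in norm: the block
  with all \<open>a j = - 1/2\<close> and \<open>b j = 1/2\<close> contains vectors of arbitrarily
  large norm. Boundedness of \<open>D\<close> alone therefore cannot bound its quadratic form there.
  With a common bound \<open>K\<close> for all coordinates, the form is at most
  \<open>K\<^sup>2\<close> times the trace of \<open>D\<close>, and the tail of the trace controls
  the truncation error in the same way. The other constraint is that the norm, the product and the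
  limit operator are definite descriptions on classes of Cauchy sequences. Existence and uniqueness
  must precede any use, so the work is done with representatives and pointwise domination by step
  functions. Once the limit operator is identified with multiplication by the full exponential, its
  semigroup laws are those of the exponential.\<close>

locale content_ring = ring_of_sets UNIV R for R :: "'a set set" +
  fixes \<mu> :: "'a set \<Rightarrow> real"
  assumes nonneg: "A \<in> R \<Longrightarrow> 0 \<le> \<mu> A"
    and additive_R: "Measure_Space.additive R \<mu>"
begin

lemma content_Un_disjoint: "A \<in> R \<Longrightarrow> B \<in> R \<Longrightarrow> A \<inter> B = {} \<Longrightarrow> \<mu> (A \<union> B) = \<mu> A + \<mu> B"
  using additive_R by (auto simp: additive_def)

lemma content_empty: "\<mu> {} = 0"
  using content_Un_disjoint[of "{}" "{}"] by simp

lemma content_Diff: "A \<in> R \<Longrightarrow> B \<in> R \<Longrightarrow> B \<subseteq> A \<Longrightarrow> \<mu> (A - B) = \<mu> A - \<mu> B"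
  using content_Un_disjoint[of B "A - B"] by (simp add: Diff Un_absorb1)

lemma content_mono: "A \<in> R \<Longrightarrow> B \<in> R \<Longrightarrow> B \<subseteq> A \<Longrightarrow> \<mu> B \<le> \<mu> A"
  using content_Diff[of A B] nonneg[of "A - B"] by (simp add: Diff)

lemma content_Un_le: "A \<in> R \<Longrightarrow> B \<in> R \<Longrightarrow> \<mu> (A \<union> B) \<le> \<mu> A + \<mu> B"
  using content_Un_disjoint[of A "B - A"] content_mono[of B "B - A"] by (simp add: Diff)

abbreviation completion :: "'a set set" where "completion \<equiv> completed_ring R \<mu>"
abbreviation outer :: "'a set \<Rightarrow> real" where "outer \<equiv> outer_measure_on R \<mu>"
abbreviation inner_content :: "'a set \<Rightarrow> real" where "inner_content \<equiv> inner_measure_on R \<mu>"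

lemma bdd_below_outer: "bdd_below (\<mu> ` {C \<in> R. A \<subseteq> C})"
  using nonneg by (auto intro!: bdd_belowI[of _ 0])

lemma bdd_above_inner: "C \<in> R \<Longrightarrow> A \<subseteq> C \<Longrightarrow> bdd_above (\<mu> ` {B \<in> R. B \<subseteq> A})"
  using content_mono by (auto intro!: bdd_aboveI[of _ "\<mu> C"])

lemma outer_le: "C \<in> R \<Longrightarrow> A \<subseteq> C \<Longrightarrow> outer A \<le> \<mu> C"
  unfolding outer_measure_on_def by (rule cINF_lower[OF bdd_below_outer]) auto

lemma inner_ge: "C \<in> R \<Longrightarrow> A \<subseteq> C \<Longrightarrow> B \<in> R \<Longrightarrow> B \<subseteq> A \<Longrightarrow> \<mu> B \<le> inner_content A"
  unfolding inner_measure_on_def by (rule cSUP_upper[OF _ bdd_above_inner]) auto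

lemma inner_le_outer:
  assumes "C \<in> R" "A \<subseteq> C" shows "inner_content A \<le> outer A"
  unfolding outer_measure_on_def inner_measure_on_def
proof (rule cINF_greatest)
  fix C' assume C': "C' \<in> {C \<in> R. A \<subseteq> C}"
  show "(SUP B\<in>{B \<in> R. B \<subseteq> A}. \<mu> B) \<le> \<mu> C'"
    using C' by (intro cSUP_least) (auto intro!: content_mono)
qed (use assms in auto)

text \<open>Turns the equality of an infimum and a supremum into a squeeze between ring sets with
  arbitrarily small gap, from which closure and additivity below start.\<close>

lemma completion_iff:
  "A \<in> completion \<longleftrightarrow> (\<forall>\<epsilon>>0. \<exists>B\<in>R. \<exists>C\<in>R. B \<subseteq> A \<and> A \<subseteq> C \<and> \<mu> (C - B) < \<epsilon>)"
proof
  assume A: "A \<in> completion"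
  then obtain C0 where C0: "C0 \<in> R" "A \<subseteq> C0" and eq: "outer A = inner_content A"
    by (auto simp: completed_ring_def)
  show "\<forall>\<epsilon>>0. \<exists>B\<in>R. \<exists>C\<in>R. B \<subseteq> A \<and> A \<subseteq> C \<and> \<mu> (C - B) < \<epsilon>"
  proof (intro allI impI)
    fix \<epsilon> :: real assume "\<epsilon> > 0"
    then have "outer A < outer A + \<epsilon> / 2" by simp
    then obtain C where C: "C \<in> R" "A \<subseteq> C" "\<mu> C < outer A + \<epsilon> / 2"
      unfolding outer_measure_on_def using C0
      by (subst (asm) cINF_less_iff[OF _ bdd_below_outer]) auto
    have "inner_content A - \<epsilon> / 2 < inner_content A" using \<open>\<epsilon> > 0\<close> by simp
    then obtain B where B: "B \<in> R" "B \<subseteq> A" "inner_content A - \<epsilon> / 2 < \<mu> B"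
      unfolding inner_measure_on_def
      by (subst (asm) less_cSUP_iff[OF _ bdd_above_inner[OF C0]]) auto
    have "\<mu> (C - B) < \<epsilon>" using content_Diff[of C B] B C eq by auto
    then show "\<exists>B\<in>R. \<exists>C\<in>R. B \<subseteq> A \<and> A \<subseteq> C \<and> \<mu> (C - B) < \<epsilon>" using B C by blast
  qed
next
  assume *: "\<forall>\<epsilon>>0. \<exists>B\<in>R. \<exists>C\<in>R. B \<subseteq> A \<and> A \<subseteq> C \<and> \<mu> (C - B) < \<epsilon>"
  then obtain C0 where C0: "C0 \<in> R" "A \<subseteq> C0" using zero_less_one by metis
  have "outer A \<le> inner_content A"
  proof (rule field_le_epsilon)
    fix \<epsilon> :: real assume "\<epsilon> > 0"
    with * obtain B C where BC: "B \<in> R" "C \<in> R" "B \<subseteq> A" "A \<subseteq> C" "\<mu> (C - B) < \<epsilon>" by metis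
    with outer_le[of C A] inner_ge[of C A B] content_Diff[of C B]
    show "outer A \<le> inner_content A + \<epsilon>" by auto
  qed
  with inner_le_outer[OF C0] C0 show "A \<in> completion" by (auto simp: completed_ring_def)
qed

lemma completionE:
  assumes "A \<in> completion" "\<epsilon> > 0"
  obtains B C where "B \<in> R" "C \<in> R" "B \<subseteq> A" "A \<subseteq> C" "\<mu> (C - B) < \<epsilon>"
  using assms unfolding completion_iff by metis

lemma R_subset_completion: "A \<in> R \<Longrightarrow> A \<in> completion"
  unfolding completion_iff using content_empty by (metis Diff_cancel order_refl)

text \<open>The uncertainty of a union or a difference lies within the union of the two gaps. In the
  difference the approximants of \<open>A2\<close> change roles: removing the larger
  \<open>C2\<close> gives the inner approximant, removing the smaller \<open>B2\<close> the outer
  one.\<close>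

lemma completion_closed:
  assumes A: "A1 \<in> completion" "A2 \<in> completion"
  shows "A1 \<union> A2 \<in> completion" "A1 - A2 \<in> completion"
proof -
  have "(\<exists>B\<in>R. \<exists>C\<in>R. B \<subseteq> A1 \<union> A2 \<and> A1 \<union> A2 \<subseteq> C \<and> \<mu> (C - B) < \<epsilon>) \<and>
     (\<exists>B\<in>R. \<exists>C\<in>R. B \<subseteq> A1 - A2 \<and> A1 - A2 \<subseteq> C \<and> \<mu> (C - B) < \<epsilon>)" if "\<epsilon> > 0" for \<epsilon>
  proof -
    from that have e: "\<epsilon> / 2 > 0" by simp
    obtain B1 C1 where 1: "B1 \<in> R" "C1 \<in> R" "B1 \<subseteq> A1" "A1 \<subseteq> C1" "\<mu> (C1 - B1) < \<epsilon> / 2"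
      using completionE[OF A(1) e] .
    obtain B2 C2 where 2: "B2 \<in> R" "C2 \<in> R" "B2 \<subseteq> A2" "A2 \<subseteq> C2" "\<mu> (C2 - B2) < \<epsilon> / 2"
      using completionE[OF A(2) e] .
    let ?D = "(C1 - B1) \<union> (C2 - B2)"
    have d: "C1 - B1 \<in> R" "C2 - B2 \<in> R" using 1 2 by auto
    then have D: "?D \<in> R" "\<mu> ?D < \<epsilon>"
      using 1 2 content_Un_le[OF d] by auto
    have "\<mu> ((C1 \<union> C2) - (B1 \<union> B2)) \<le> \<mu> ?D"
      using 1 2 by (intro content_mono Un Diff) auto
    moreover have "\<mu> ((C1 - B2) - (B1 - C2)) \<le> \<mu> ?D"
      using 1 2 by (intro content_mono Un Diff) auto
    ultimately have *: "\<mu> ((C1 \<union> C2) - (B1 \<union> B2)) < \<epsilon>" "\<mu> ((C1 - B2) - (B1 - C2)) < \<epsilon>"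
      using D by auto
    show ?thesis
    proof
      show "\<exists>B\<in>R. \<exists>C\<in>R. B \<subseteq> A1 \<union> A2 \<and> A1 \<union> A2 \<subseteq> C \<and> \<mu> (C - B) < \<epsilon>"
        by (rule bexI[of _ "B1 \<union> B2"], rule bexI[of _ "C1 \<union> C2"]) (use 1 2 *(1) in auto)
      show "\<exists>B\<in>R. \<exists>C\<in>R. B \<subseteq> A1 - A2 \<and> A1 - A2 \<subseteq> C \<and> \<mu> (C - B) < \<epsilon>"
        by (rule bexI[of _ "B1 - C2"], rule bexI[of _ "C1 - B2"]) (use 1 2 *(2) in auto)
    qed
  qed
  then show "A1 \<union> A2 \<in> completion" "A1 - A2 \<in> completion"
    by (simp_all add: completion_iff)
qed

lemma ring_completion: "ring_of_sets UNIV completion"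
  using completion_closed R_subset_completion[OF empty_sets] by (auto simp: ring_of_sets_iff)

sublocale completion: ring_of_sets UNIV completion
  by (rule ring_completion)

lemma outer_nonneg: "A \<in> completion \<Longrightarrow> 0 \<le> outer A"
  unfolding outer_measure_on_def completed_ring_def using nonneg
  by (intro cINF_greatest) auto

text \<open>Both sides lie between \<open>\<mu> B1 + \<mu> B2\<close> and
  \<open>\<mu> C1 + \<mu> C2\<close>, which differ by less than \<open>\<epsilon>\<close>. The inner
  sets inherit disjointness and add up exactly; the outer ones may overlap, where subadditivity
  suffices.\<close>

lemma outer_Un:
  assumes A: "A1 \<in> completion" "A2 \<in> completion" and disj: "A1 \<inter> A2 = {}"
  shows "outer (A1 \<union> A2) = outer A1 + outer A2"
proof -
  have "\<bar>outer (A1 \<union> A2) - (outer A1 + outer A2)\<bar> \<le> \<epsilon>" if "\<epsilon> > 0" for \<epsilon>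
  proof -
    from that have e: "\<epsilon> / 2 > 0" by simp
    obtain B1 C1 where 1: "B1 \<in> R" "C1 \<in> R" "B1 \<subseteq> A1" "A1 \<subseteq> C1" "\<mu> (C1 - B1) < \<epsilon> / 2"
      using completionE[OF A(1) e] .
    obtain B2 C2 where 2: "B2 \<in> R" "C2 \<in> R" "B2 \<subseteq> A2" "A2 \<subseteq> C2" "\<mu> (C2 - B2) < \<epsilon> / 2"
      using completionE[OF A(2) e] .
    have eq: "outer A1 = inner_content A1" "outer A2 = inner_content A2"
      "outer (A1 \<union> A2) = inner_content (A1 \<union> A2)"
      using A completion.Un[OF A] by (auto simp: completed_ring_def)
    have "\<mu> B1 \<le> outer A1" "outer A1 \<le> \<mu> C1" "\<mu> B2 \<le> outer A2" "outer A2 \<le> \<mu> C2"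
      using inner_ge[of C1 A1 B1] inner_ge[of C2 A2 B2] outer_le[of C1 A1] outer_le[of C2 A2] 1 2 eq
      by auto
    moreover have "\<mu> (B1 \<union> B2) \<le> outer (A1 \<union> A2)" unfolding eq
      using inner_ge[of "C1 \<union> C2" "A1 \<union> A2" "B1 \<union> B2"] 1 2 by auto
    moreover have "outer (A1 \<union> A2) \<le> \<mu> (C1 \<union> C2)"
      using outer_le[of "C1 \<union> C2" "A1 \<union> A2"] 1 2 by auto
    moreover have "\<mu> (B1 \<union> B2) = \<mu> B1 + \<mu> B2"
      using 1 2 disj by (intro content_Un_disjoint) auto
    moreover have "\<mu> (C1 - B1) = \<mu> C1 - \<mu> B1" "\<mu> (C2 - B2) = \<mu> C2 - \<mu> B2"
      using 1 2 by (auto intro!: content_Diff)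
    ultimately show ?thesis using content_Un_le[of C1 C2] 1 2 by linarith
  qed
  then have "\<bar>outer (A1 \<union> A2) - (outer A1 + outer A2)\<bar> \<le> 0"
    by (rule field_le_epsilon) simp
  then show ?thesis by simp
qed

lemma outer_empty: "outer {} = 0"
proof -
  have "outer ({} \<union> {}) = outer {} + outer {}"
    by (rule outer_Un) (rule completion.empty_sets Int_empty_left)+
  then show ?thesis by simp
qed

lemma outer_UN:
  assumes "finite I" "\<And>i. i \<in> I \<Longrightarrow> B i \<in> completion" "disjoint_family_on B I"
  shows "outer (\<Union>i\<in>I. B i) = (\<Sum>i\<in>I. outer (B i))"
  using assms
proof (induction I rule: finite_induct)
  case (insert i I)
  have "B i \<inter> (\<Union>j\<in>I. B j) = {}"
  proof -
    have "B i \<inter> B j = {}" if "j \<in> I" for j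
      using that insert.hyps(2) by (intro disjoint_family_onD[OF insert.prems(2)]) auto
    then show ?thesis by blast
  qed
  moreover have "outer (\<Union>j\<in>I. B j) = (\<Sum>j\<in>I. outer (B j))"
    using insert.prems(1) disjoint_family_on_mono[OF subset_insertI insert.prems(2)]
    by (intro insert.IH) simp_all
  moreover have "(\<Union>j\<in>I. B j) \<in> completion"
    using insert.prems(1) insert.hyps(1) by (intro completion.finite_UN) simp_all
  ultimately show ?case using insert.prems(1) insert.hyps by (simp add: outer_Un)
qed (simp add: outer_empty)

section \<open>Step functions\<close>

abbreviation "S \<equiv> step_functions R \<mu>"
abbreviation "N \<equiv> step_norm R \<mu>"

text \<open>Level sets do not depend on how a step function is written, so they can serve as its
  canonical pieces. The value 0 is left out because it is also taken outside all pieces.\<close>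

lemma representation_vimage:
  assumes f: "step_representation R \<mu> f n c B" and y: "y \<noteq> 0"
  shows "f -` {y} = (\<Union>k\<in>{k\<in>{..<n}. c k = y}. B k)"
proof -
  have disj: "disjoint_family_on B {..<n}" and feq: "f = (\<lambda>x. \<Sum>k<n. c k * indicator (B k) x)"
    using f by (auto simp: step_representation_def)
  have val: "f x = c k" if "k < n" "x \<in> B k" for k x
  proof -
    have "(\<Sum>j<n. c j * indicator (B j) x) = (\<Sum>j\<in>{k}. c j * indicator (B j) x)"
      using that disj by (intro sum.mono_neutral_right) (auto simp: disjoint_family_on_def indicator_def)
    then show ?thesis using that feq by simp
  qed
  have val0: "f x = 0" if "\<And>k. k < n \<Longrightarrow> x \<notin> B k" for x
    using that unfolding feq by (intro sum.neutral) auto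
  show ?thesis using val val0 y by (auto simp: vimage_def) metis
qed

lemma representation_range:
  assumes f: "step_representation R \<mu> f n c B"
  shows "range f \<subseteq> insert 0 (c ` {..<n})"
proof
  fix y assume "y \<in> range f"
  then have "f -` {y} \<noteq> {}" by auto
  then show "y \<in> insert 0 (c ` {..<n})"
    using representation_vimage[OF f, of y] by (cases "y = 0") auto
qed

text \<open>\<open>step_norm\<close> is a definite description over all representations. Collecting
  the pieces that carry the same value rewrites its sum through the level sets of \<open>f\<close>
  alone.\<close>

lemma representation_sum:
  assumes f: "step_representation R \<mu> f n c B"
  shows "(\<Sum>k<n. (cmod (c k))\<^sup>2 * outer (B k)) =
    (\<Sum>y\<in>range f - {0}. (cmod y)\<^sup>2 * outer (f -` {y}))"
proof -
  \<comment> \<open>Empty pieces go along with zero coefficients: the coefficient of an empty piece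
    need not be a value of \<open>f\<close>, and the grouping below is over the values of
    \<open>f\<close>.\<close>
  let ?K = "{k\<in>{..<n}. c k \<noteq> 0 \<and> B k \<noteq> {}}"
  have B: "\<And>k. k < n \<Longrightarrow> B k \<in> completion" and disj: "disjoint_family_on B {..<n}"
    using f by (auto simp: step_representation_def)
  have fin: "finite (range f - {0})"
    using representation_range[OF f] by (auto intro: finite_subset)
  have img: "c ` ?K \<subseteq> range f - {0}"
  proof
    fix y assume "y \<in> c ` ?K"
    then obtain k x where k: "k < n" "c k \<noteq> 0" "y = c k" "x \<in> B k" by auto
    then have "x \<in> f -` {c k}" by (auto simp: representation_vimage[OF f])
    then have "f x = y" using k by simp
    then show "y \<in> range f - {0}" using rangeI[of f x] k by simp
  qed
  have "(\<Sum>k<n. (cmod (c k))\<^sup>2 * outer (B k)) = (\<Sum>k\<in>?K. (cmod (c k))\<^sup>2 * outer (B k))"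
    by (intro sum.mono_neutral_right) (auto simp: outer_empty)
  also have "\<dots> = (\<Sum>y\<in>range f - {0}. \<Sum>k\<in>{k\<in>?K. c k = y}. (cmod (c k))\<^sup>2 * outer (B k))"
    using fin img by (intro sum.group[symmetric]) auto
  also have "\<dots> = (\<Sum>y\<in>range f - {0}. (cmod y)\<^sup>2 * outer (f -` {y}))"
  proof (intro sum.cong refl)
    fix y assume y: "y \<in> range f - {0}"
    have "f -` {y} = (\<Union>k\<in>{k\<in>?K. c k = y}. B k)"
      using representation_vimage[OF f, of y] y by auto
    also have "outer \<dots> = (\<Sum>k\<in>{k\<in>?K. c k = y}. outer (B k))"
      using B disj by (intro outer_UN) (auto simp: disjoint_family_on_def)
    finally show "(\<Sum>k\<in>{k\<in>?K. c k = y}. (cmod (c k))\<^sup>2 * outer (B k)) = (cmod y)\<^sup>2 * outer (f -` {y})"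
      by (auto simp: sum_distrib_left intro!: sum.cong)
  qed
  finally show ?thesis .
qed

lemma step_norm_eq:
  assumes f: "step_representation R \<mu> f n c B"
  shows "N f = sqrt (\<Sum>k<n. (cmod (c k))\<^sup>2 * outer (B k))"
  unfolding step_norm_def
proof (rule the_equality)
  fix r assume "\<exists>n c B. step_representation R \<mu> f n c B \<and>
    r = sqrt (\<Sum>k<n. (cmod (c k))\<^sup>2 * outer (B k))"
  then obtain m a A where r: "step_representation R \<mu> f m a A"
    "r = sqrt (\<Sum>k<m. (cmod (a k))\<^sup>2 * outer (A k))" by (elim exE conjE)
  show "r = sqrt (\<Sum>k<n. (cmod (c k))\<^sup>2 * outer (B k))"
    unfolding r(2) representation_sum[OF f] representation_sum[OF r(1)] ..
next
  show "\<exists>m a A. step_representation R \<mu> f m a A \<and>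
      sqrt (\<Sum>k<n. (cmod (c k))\<^sup>2 * outer (B k)) = sqrt (\<Sum>k<m. (cmod (a k))\<^sup>2 * outer (A k))"
    by (intro exI conjI) (rule f, rule refl)
qed

text \<open>\<open>z\<close> is the value off the support: its fibre may lie outside the completion,
  and \<open>\<phi> z = 0\<close> keeps it out of the sum. The general value type of
  \<open>h\<close> lets one statement serve a single step function and, with
  \<open>z = (0, 0)\<close>, a pair.\<close>

lemma step_comp:
  fixes h :: "'a \<Rightarrow> 'b" and \<phi> :: "'b \<Rightarrow> complex"
  assumes fin: "finite (range h)" and h: "\<And>y. y \<noteq> z \<Longrightarrow> h -` {y} \<in> completion" and \<phi>: "\<phi> z = 0"
  shows "(\<lambda>x. \<phi> (h x)) \<in> S"
    and "N (\<lambda>x. \<phi> (h x)) = L2_set (\<lambda>y. cmod (\<phi> y) * sqrt (outer (h -` {y}))) (range h - {z})"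
proof -
  have "finite (range h - {z})" using fin by simp
  from ex_bij_betw_nat_finite[OF this] obtain y
    where "bij_betw y {0..<card (range h - {z})} (range h - {z})" ..
  moreover define n where "n = card (range h - {z})"
  ultimately have bij: "bij_betw y {..<n} (range h - {z})" by (simp add: atLeast0LessThan)
  define B where "B k = h -` {y k}" for k
  have yz: "y k \<noteq> z" if "k < n" for k
    using bij that by (auto simp: bij_betw_def)
  have rep: "step_representation R \<mu> (\<lambda>x. \<phi> (h x)) n (\<lambda>k. \<phi> (y k)) B"
    unfolding step_representation_def
  proof (intro conjI allI impI ext)
    show "B k \<in> completion" if "k < n" for k using yz[OF that] h by (simp add: B_def)
    show "disjoint_family_on B {..<n}"
      using bij by (auto simp: B_def disjoint_family_on_def bij_betw_def inj_on_def)
    fix x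
    show "\<phi> (h x) = (\<Sum>k<n. \<phi> (y k) * indicator (B k) x)"
    proof (cases "h x = z")
      case True
      then have "x \<notin> B k" if "k < n" for k using yz[OF that] by (auto simp: B_def)
      then have "(\<Sum>k<n. \<phi> (y k) * indicator (B k) x) = 0"
        by (intro sum.neutral) auto
      then show ?thesis using True \<phi> by simp
    next
      case False
      then obtain k where k: "k < n" "h x = y k"
        using bij by (auto simp: bij_betw_def)
      then have "(\<Sum>j<n. \<phi> (y j) * indicator (B j) x) = (\<Sum>j\<in>{k}. \<phi> (y j) * indicator (B j) x)"
        using bij by (intro sum.mono_neutral_right) (auto simp: B_def indicator_def bij_betw_def inj_on_def)
      then show ?thesis using k by (simp add: B_def)
    qed
  qed
  show "(\<lambda>x. \<phi> (h x)) \<in> S" unfolding step_functions_def using rep by blast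
  have "N (\<lambda>x. \<phi> (h x)) = sqrt (\<Sum>k<n. (cmod (\<phi> (y k)))\<^sup>2 * outer (h -` {y k}))"
    using step_norm_eq[OF rep] by (simp add: B_def)
  also have "(\<Sum>k<n. (cmod (\<phi> (y k)))\<^sup>2 * outer (h -` {y k})) =
      (\<Sum>y\<in>range h - {z}. (cmod (\<phi> y))\<^sup>2 * outer (h -` {y}))"
    using sum.reindex_bij_betw[OF bij, of "\<lambda>y. (cmod (\<phi> y))\<^sup>2 * outer (h -` {y})"] .
  also have "\<dots> = (\<Sum>y\<in>range h - {z}. (cmod (\<phi> y) * sqrt (outer (h -` {y})))\<^sup>2)"
    using h by (intro sum.cong) (auto simp: power_mult_distrib outer_nonneg)
  finally show "N (\<lambda>x. \<phi> (h x)) =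
      L2_set (\<lambda>y. cmod (\<phi> y) * sqrt (outer (h -` {y}))) (range h - {z})"
    by (simp add: L2_set_def)
qed

lemma step_functions_iff: "f \<in> S \<longleftrightarrow> finite (range f) \<and> (\<forall>y. y \<noteq> 0 \<longrightarrow> f -` {y} \<in> completion)"
proof
  assume "f \<in> S"
  then obtain n c B where f: "step_representation R \<mu> f n c B" by (auto simp: step_functions_def)
  have "f -` {y} \<in> completion" if "y \<noteq> 0" for y
    unfolding representation_vimage[OF f that] using f
    by (intro completion.finite_UN) (auto simp: step_representation_def)
  with representation_range[OF f] show "finite (range f) \<and> (\<forall>y. y \<noteq> 0 \<longrightarrow> f -` {y} \<in> completion)"
    by (auto intro: finite_subset)
next
  assume "finite (range f) \<and> (\<forall>y. y \<noteq> 0 \<longrightarrow> f -` {y} \<in> completion)"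
  then show "f \<in> S" using step_comp(1)[of f 0 "\<lambda>y. y"] by auto
qed

lemma step_support_completion:
  assumes "h \<in> S" shows "h -` (UNIV - {0}) \<in> completion"
proof -
  have "h -` (UNIV - {0}) = (\<Union>y\<in>range h - {0}. h -` {y})" by auto
  also have "\<dots> \<in> completion" using assms
    by (intro completion.finite_UN) (auto simp: step_functions_iff)
  finally show ?thesis .
qed

text \<open>The link between \<open>H\<close> and the ring: the outer approximant of the support, at
  any tolerance, is a ring set carrying \<open>h\<close>. Control of a multiplier on ring sets is
  thereby control wherever a step function is nonzero.\<close>

lemma step_support:
  assumes "h \<in> S" obtains C where "C \<in> R" "\<And>x. x \<notin> C \<Longrightarrow> h x = 0"
proof -
  obtain C where "C \<in> R" "h -` (UNIV - {0}) \<subseteq> C"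
    using completionE[OF step_support_completion[OF assms] zero_less_one] .
  then show thesis by (intro that[of C]) auto
qed

text \<open>Two step functions are combined by refining to the level sets of the pair; all norms of
  combinations of \<open>f\<close> and \<open>g\<close> are then \<open>\<ell>\<^sup>2\<close> norms over one weighted finite set.\<close>

lemma step_pair:
  assumes f: "f \<in> S" and g: "g \<in> S"
  obtains w T where "\<And>p. w p \<ge> 0"
    "T \<subseteq> range (\<lambda>x. (f x, g x))"
    "\<And>\<phi> :: complex \<times> complex \<Rightarrow> complex. \<phi> (0, 0) = 0 \<Longrightarrow> (\<lambda>x. \<phi> (f x, g x)) \<in> S"
    "\<And>\<phi> :: complex \<times> complex \<Rightarrow> complex. \<phi> (0, 0) = 0 \<Longrightarrow>
       N (\<lambda>x. \<phi> (f x, g x)) = L2_set (\<lambda>p. cmod (\<phi> p) * w p) T"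
proof -
  let ?h = "\<lambda>x. (f x, g x)"
  have fin: "finite (range ?h)"
    by (rule finite_subset[of _ "range f \<times> range g"]) (use f g in \<open>auto simp: step_functions_iff\<close>)
  have lev: "?h -` {p} \<in> completion" if p: "p \<noteq> (0, 0)" for p
  proof -
    obtain y z where yz: "p = (y, z)" by fastforce
    have f': "f -` {y} \<in> completion" if "y \<noteq> 0" using f that by (auto simp: step_functions_iff)
    have g': "g -` {z} \<in> completion" if "z \<noteq> 0" using g that by (auto simp: step_functions_iff)
    note supp = step_support_completion[OF f] step_support_completion[OF g]
    \<comment> \<open>The zero fibre of a step function need not be in the completion, so when one
      component is 0 the support of that function is subtracted from the fibre of the other.\<close>
    consider "y \<noteq> 0" "z \<noteq> 0" | "y = 0" "z \<noteq> 0" | "y \<noteq> 0" "z = 0" using p yz by auto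
    then show ?thesis
    proof cases
      case 1
      have "?h -` {p} = f -` {y} \<inter> g -` {z}" using yz by auto
      with 1 f' g' show ?thesis by auto
    next
      case 2
      have "?h -` {p} = g -` {z} - f -` (UNIV - {0})" using yz 2 by auto
      with 2 g' supp show ?thesis by auto
    next
      case 3
      have "?h -` {p} = f -` {y} - g -` (UNIV - {0})" using yz 3 by auto
      with 3 f' supp show ?thesis by auto
    qed
  qed
  \<comment> \<open>The fibre over \<open>(0, 0)\<close> may have no cover in the ring, which leaves
    its outer measure without meaning; weight 0 there makes all weights nonnegative.\<close>
  let ?w = "\<lambda>p. if p = (0, 0) then 0 else sqrt (outer (?h -` {p}))"
  show thesis
  proof (rule that[of ?w "range ?h - {(0, 0)}"])
    fix p show "?w p \<ge> 0" by (simp add: outer_nonneg lev)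
  next
    show "range ?h - {(0, 0)} \<subseteq> range ?h" by (rule Diff_subset)
  next
    fix \<phi> :: "complex \<times> complex \<Rightarrow> complex" assume "\<phi> (0, 0) = 0"
    note sc = step_comp[where h="?h" and z="(0, 0)" and \<phi>=\<phi>, OF fin _ this]
    show "(\<lambda>x. \<phi> (f x, g x)) \<in> S" by (rule sc(1)) (rule lev)
    have "N (\<lambda>x. \<phi> (f x, g x)) =
        L2_set (\<lambda>p. cmod (\<phi> p) * sqrt (outer (?h -` {p}))) (range ?h - {(0, 0)})"
      by (rule sc(2)) (rule lev)
    also have "\<dots> = L2_set (\<lambda>p. cmod (\<phi> p) * ?w p) (range ?h - {(0, 0)})"
      by (rule L2_set_cong) auto
    finally show "N (\<lambda>x. \<phi> (f x, g x)) =
        L2_set (\<lambda>p. cmod (\<phi> p) * ?w p) (range ?h - {(0, 0)})" .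
  qed
qed

lemma step_combine:
  assumes "f \<in> S" "g \<in> S" "\<phi> 0 0 = 0" shows "(\<lambda>x. \<phi> (f x) (g x)) \<in> S"
proof (rule step_pair[OF assms(1,2)])
  fix w :: "complex \<times> complex \<Rightarrow> real" and T :: "(complex \<times> complex) set"
  assume *: "\<And>\<psi> :: complex \<times> complex \<Rightarrow> complex. \<psi> (0, 0) = 0 \<Longrightarrow> (\<lambda>x. \<psi> (f x, g x)) \<in> S"
  have "(\<lambda>x. (\<lambda>p. \<phi> (fst p) (snd p)) (f x, g x)) \<in> S"
    by (rule *[of "\<lambda>p. \<phi> (fst p) (snd p)"]) (simp add: assms(3))
  then show ?thesis by simp
qed

section \<open>Arithmetic and norm estimates for step functions\<close>

lemma step_add: "f \<in> S \<Longrightarrow> g \<in> S \<Longrightarrow> (\<lambda>x. f x + g x) \<in> S"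
  by (rule step_combine[where \<phi>="(+)"]) simp_all

lemma step_diff: "f \<in> S \<Longrightarrow> g \<in> S \<Longrightarrow> (\<lambda>x. f x - g x) \<in> S"
  by (rule step_combine[where \<phi>="(-)"]) simp_all

lemma step_mult: "f \<in> S \<Longrightarrow> g \<in> S \<Longrightarrow> (\<lambda>x. f x * g x) \<in> S"
  by (rule step_combine[where \<phi>="\<lambda>y z. y * z"]) simp_all

lemma step_scale: "f \<in> S \<Longrightarrow> (\<lambda>x. c * f x) \<in> S"
  by (rule step_combine[of f f "\<lambda>y z. c * y"]) simp_all

lemma step_abs: "f \<in> S \<Longrightarrow> (\<lambda>x. complex_of_real (cmod (f x))) \<in> S"
  by (rule step_combine[of f f "\<lambda>y z. complex_of_real (cmod y)"]) simp_all

lemma step_indicator: "A \<in> completion \<Longrightarrow> indicator A \<in> S"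
proof -
  assume A: "A \<in> completion"
  have "finite (range (indicator A :: 'a \<Rightarrow> complex))"
    by (rule finite_subset[of _ "{0, 1}"]) (auto simp: indicator_def)
  moreover have "(indicator A :: 'a \<Rightarrow> complex) -` {y} \<in> completion" if "y \<noteq> 0" for y
  proof (cases "y = 1")
    case True
    then have "(indicator A :: 'a \<Rightarrow> complex) -` {y} = A" by (auto simp: indicator_def)
    with A show ?thesis by simp
  next
    case False
    then have "(indicator A :: 'a \<Rightarrow> complex) -` {y} = {}" using that by (auto simp: indicator_def)
    then show ?thesis by simp
  qed
  ultimately show ?thesis by (simp add: step_functions_iff)
qed

lemma step_sum:
  assumes "finite I" "\<And>i. i \<in> I \<Longrightarrow> f i \<in> S" shows "(\<lambda>x. \<Sum>i\<in>I. f i x) \<in> S"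
  using assms
proof (induction I rule: finite_induct)
  case empty
  show ?case using step_indicator[OF completion.empty_sets] by (simp add: indicator_def[abs_def])
next
  case (insert i I) then show ?case by (simp add: step_add)
qed

lemma step_zero: "(\<lambda>x. 0) \<in> S"
  using step_sum[of "{}"] by simp

lemma step_norm_L2:
  assumes f: "f \<in> S" and \<phi>: "\<phi> 0 = 0"
  shows "N (\<lambda>x. \<phi> (f x)) = L2_set (\<lambda>y. cmod (\<phi> y) * sqrt (outer (f -` {y}))) (range f - {0})"
  by (rule step_comp(2)[where \<phi>=\<phi>]) (use f \<phi> in \<open>simp_all add: step_functions_iff\<close>)

lemma step_norm_nonneg: "f \<in> S \<Longrightarrow> 0 \<le> N f"
  using step_norm_L2[of f "\<lambda>y. y"] by (simp add: L2_set_nonneg)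

text \<open>Over the joint level sets both norms are sums with the same weights. The pointwise bound
  only speaks of values taken at a common point, so it matters that \<open>T\<close> lies in the
  range of the pair.\<close>

lemma step_norm_mono:
  assumes "f \<in> S" "g \<in> S" "\<And>x. cmod (f x) \<le> cmod (g x)" shows "N f \<le> N g"
proof (rule step_pair[OF assms(1,2)])
  fix w :: "complex \<times> complex \<Rightarrow> real" and T :: "(complex \<times> complex) set"
  assume w: "\<And>p. w p \<ge> 0" and T: "T \<subseteq> range (\<lambda>x. (f x, g x))"
    and n: "\<And>\<phi> :: complex \<times> complex \<Rightarrow> complex. \<phi> (0, 0) = 0 \<Longrightarrow>
       N (\<lambda>x. \<phi> (f x, g x)) = L2_set (\<lambda>p. cmod (\<phi> p) * w p) T"
  have "L2_set (\<lambda>p. cmod (fst p) * w p) T \<le> L2_set (\<lambda>p. cmod (snd p) * w p) T"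
  proof (rule L2_set_mono)
    fix p assume "p \<in> T"
    then obtain x where "p = (f x, g x)" using T by auto
    then show "cmod (fst p) * w p \<le> cmod (snd p) * w p"
      using assms(3)[of x] w by (simp add: mult_right_mono)
  qed (simp add: w)
  then show ?thesis using n[of fst] n[of snd] by simp
qed

lemma step_norm_triangle:
  assumes "f \<in> S" "g \<in> S" shows "N (\<lambda>x. f x + g x) \<le> N f + N g"
proof (rule step_pair[OF assms(1,2)])
  fix w :: "complex \<times> complex \<Rightarrow> real" and T :: "(complex \<times> complex) set"
  assume w: "\<And>p. w p \<ge> 0" and T: "T \<subseteq> range (\<lambda>x. (f x, g x))"
    and n: "\<And>\<phi> :: complex \<times> complex \<Rightarrow> complex. \<phi> (0, 0) = 0 \<Longrightarrow>
       N (\<lambda>x. \<phi> (f x, g x)) = L2_set (\<lambda>p. cmod (\<phi> p) * w p) T"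
  have "L2_set (\<lambda>p. cmod (fst p + snd p) * w p) T
      \<le> L2_set (\<lambda>p. cmod (fst p) * w p + cmod (snd p) * w p) T"
    by (rule L2_set_mono) (simp_all add: w mult_right_mono norm_triangle_ineq flip: distrib_right)
  also have "\<dots> \<le> L2_set (\<lambda>p. cmod (fst p) * w p) T + L2_set (\<lambda>p. cmod (snd p) * w p) T"
    by (rule L2_set_triangle_ineq)
  finally show ?thesis using n[of fst] n[of snd] n[of "\<lambda>p. fst p + snd p"] by simp
qed

lemma step_norm_scale: "f \<in> S \<Longrightarrow> N (\<lambda>x. c * f x) = cmod c * N f"
  using step_norm_L2[of f "\<lambda>y. y"] step_norm_L2[of f "\<lambda>y. c * y"]
  by (simp add: norm_mult mult.assoc L2_set_right_distrib)

lemma step_norm_zero: "N (\<lambda>x. 0) = 0"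
  using step_norm_scale[OF step_zero, of 0] by simp

lemma step_norm_abs:
  assumes "f \<in> S" shows "N (\<lambda>x. complex_of_real (cmod (f x))) = N f"
  using assms step_abs[OF assms] by (intro antisym step_norm_mono) auto

lemma cmod_abs_add [simp]:
  "cmod (complex_of_real (cmod y) + complex_of_real (cmod z)) = cmod y + cmod z"
  by (simp flip: of_real_add del: of_real_add)

lemma step_abs_add:
  assumes "f \<in> S" "g \<in> S"
  shows "(\<lambda>x. complex_of_real (cmod (f x)) + complex_of_real (cmod (g x))) \<in> S"
    and "N (\<lambda>x. complex_of_real (cmod (f x)) + complex_of_real (cmod (g x))) \<le> N f + N g"
  using step_norm_triangle[OF step_abs[OF assms(1)] step_abs[OF assms(2)]] assms
  by (simp_all add: step_norm_abs step_add step_abs)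

text \<open>The sum of the moduli of \<open>f\<close> and \<open>g\<close> is again a step function,
  so a pointwise bound by two functions becomes one application of monotonicity.\<close>

lemma step_norm_dominated:
  assumes "h \<in> S" "f \<in> S" "g \<in> S" "\<And>x. cmod (h x) \<le> cmod (f x) + cmod (g x)"
  shows "N h \<le> N f + N g"
proof -
  have "N h \<le> N (\<lambda>x. complex_of_real (cmod (f x)) + complex_of_real (cmod (g x)))"
    using assms by (intro step_norm_mono step_abs_add) simp_all
  also have "\<dots> \<le> N f + N g" using assms by (intro step_abs_add)
  finally show ?thesis .
qed

lemma step_norm_dominated3:
  assumes "h \<in> S" "f \<in> S" "g \<in> S" "k \<in> S" "\<And>x. cmod (h x) \<le> cmod (f x) + cmod (g x) + cmod (k x)"
  shows "N h \<le> N f + N g + N k"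
proof -
  let ?a = "\<lambda>x. complex_of_real (cmod (f x)) + complex_of_real (cmod (g x))"
  have "N h \<le> N ?a + N k" using assms by (intro step_norm_dominated step_abs_add) simp_all
  also have "N ?a \<le> N f + N g" using assms by (intro step_abs_add)
  finally show ?thesis by simp
qed

section \<open>The completed Hilbert space\<close>

abbreviation "cauchy \<equiv> step_Cauchy R \<mu>"
abbreviation "cls s \<equiv> step_equiv R \<mu> `` {s}"
abbreviation "H \<equiv> H_space R \<mu>"

lemma cauchy_step: "s \<in> cauchy \<Longrightarrow> s n \<in> S"
  by (simp add: step_Cauchy_def)

lemma cauchyE:
  assumes "s \<in> cauchy" "\<epsilon> > 0"
  obtains M where "\<And>m n. m \<ge> M \<Longrightarrow> n \<ge> M \<Longrightarrow> N (\<lambda>x. s m x - s n x) < \<epsilon>"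
proof -
  from assms have "\<exists>M. \<forall>m\<ge>M. \<forall>n\<ge>M. N (\<lambda>x. s m x - s n x) < \<epsilon>" by (simp add: step_Cauchy_def)
  with that show thesis by blast
qed

text \<open>One criterion for all constructions on sequences: \<open>s\<close> with factor
  \<open>K\<close> covers scaling and contractions, \<open>r\<close> a second summand, and
  \<open>g\<close> approximation errors, of which only vanishing norms are known.\<close>

lemma cauchy_dominated:
  assumes s: "s \<in> cauchy" and r: "r \<in> cauchy" and q: "\<And>n. q n \<in> S" and g: "\<And>n. g n \<in> S"
    and g0: "(\<lambda>n. N (g n)) \<longlonglongrightarrow> 0"
    and dom: "\<And>m n x. cmod (q m x - q n x) \<le>
      K * cmod (s m x - s n x) + cmod (r m x - r n x) + (cmod (g m x) + cmod (g n x))"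
  shows "q \<in> cauchy"
proof -
  have K: "K \<le> \<bar>K\<bar>" by simp
  have le: "N (\<lambda>x. q m x - q n x) \<le>
      \<bar>K\<bar> * N (\<lambda>x. s m x - s n x) + N (\<lambda>x. r m x - r n x) + (N (g m) + N (g n))" for m n
  proof -
    note S = cauchy_step[OF s] cauchy_step[OF r] q g
    let ?G = "\<lambda>x. complex_of_real (cmod (g m x)) + complex_of_real (cmod (g n x))"
    have "N (\<lambda>x. q m x - q n x) \<le>
        N (\<lambda>x. complex_of_real K * (s m x - s n x)) + N (\<lambda>x. r m x - r n x) + N ?G"
    proof (rule step_norm_dominated3)
      fix x
      have "K * cmod (s m x - s n x) \<le> \<bar>K\<bar> * cmod (s m x - s n x)"
        by (rule mult_right_mono) simp_all
      then show "cmod (q m x - q n x) \<le> cmod (complex_of_real K * (s m x - s n x)) +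
          cmod (r m x - r n x) + cmod (?G x)"
        using dom[of m x n] by (simp add: norm_mult)
    qed (intro step_diff step_scale step_abs_add S)+
    also have "N (\<lambda>x. complex_of_real K * (s m x - s n x)) = \<bar>K\<bar> * N (\<lambda>x. s m x - s n x)"
      by (subst step_norm_scale) (simp_all add: step_diff S)
    also have "N ?G \<le> N (g m) + N (g n)" by (intro step_abs_add S)
    finally show ?thesis by simp
  qed
  have "\<exists>M. \<forall>m\<ge>M. \<forall>n\<ge>M. N (\<lambda>x. q m x - q n x) < \<epsilon>" if "\<epsilon> > 0" for \<epsilon>
  proof -
    \<comment> \<open>Four summands get a quarter of \<open>\<epsilon>\<close> each; the divisor
      contains \<open>\<bar>K\<bar> + 1\<close> because \<open>K\<close> may be 0 or
      negative.\<close>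
    have "\<epsilon> / (4 * (\<bar>K\<bar> + 1)) > 0" "\<epsilon> / 4 > 0" using that by simp_all
    from cauchyE[OF s this(1)] cauchyE[OF r this(2)] obtain M1 M2
      where M1: "\<And>m n. m \<ge> M1 \<Longrightarrow> n \<ge> M1 \<Longrightarrow> N (\<lambda>x. s m x - s n x) < \<epsilon> / (4 * (\<bar>K\<bar> + 1))"
        and M2: "\<And>m n. m \<ge> M2 \<Longrightarrow> n \<ge> M2 \<Longrightarrow> N (\<lambda>x. r m x - r n x) < \<epsilon> / 4" by metis
    from order_tendstoD(2)[OF g0 \<open>\<epsilon> / 4 > 0\<close>] obtain M3 where M3: "\<And>n. n \<ge> M3 \<Longrightarrow> N (g n) < \<epsilon> / 4"
      by (auto simp: eventually_sequentially)
    have "N (\<lambda>x. q m x - q n x) < \<epsilon>" if "m \<ge> M1 + M2 + M3" "n \<ge> M1 + M2 + M3" for m n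
    proof -
      have "\<bar>K\<bar> * N (\<lambda>x. s m x - s n x) \<le> (\<bar>K\<bar> + 1) * (\<epsilon> / (4 * (\<bar>K\<bar> + 1)))"
        using M1[of m n] that
        by (intro mult_mono step_norm_nonneg step_diff cauchy_step[OF s]) simp_all
      also have "\<dots> = \<epsilon> / 4" by (simp add: field_simps)
      finally show ?thesis using le[of m n] M2[of m n] M3[of m] M3[of n] that by simp
    qed
    then show ?thesis by blast
  qed
  then show ?thesis using q by (simp add: step_Cauchy_def)
qed

lemma cauchy_zero: "(\<lambda>n x. 0) \<in> cauchy"
  by (auto simp: step_Cauchy_def step_zero step_norm_zero)

lemma cauchy_add: "s \<in> cauchy \<Longrightarrow> r \<in> cauchy \<Longrightarrow> (\<lambda>n x. s n x + r n x) \<in> cauchy"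
  by (rule cauchy_dominated[where s=s and r=r and g="\<lambda>n x. 0" and K=1])
    (simp_all add: step_add cauchy_step step_zero step_norm_zero add_diff_add norm_triangle_ineq)

lemma cauchy_scale: "s \<in> cauchy \<Longrightarrow> (\<lambda>n x. c * s n x) \<in> cauchy"
  by (rule cauchy_dominated[where s=s and r="\<lambda>n x. 0" and g="\<lambda>n x. 0" and K="cmod c"])
    (simp_all add: step_scale cauchy_step step_zero step_norm_zero cauchy_zero norm_mult
      flip: right_diff_distrib)

lemma cauchy_diff:
  assumes "s \<in> cauchy" "r \<in> cauchy" shows "(\<lambda>n x. s n x - r n x) \<in> cauchy"
  using cauchy_add[OF assms(1) cauchy_scale[OF assms(2), of "- 1"]] by simp

lemma step_norm_diff_le:
  assumes "f \<in> S" "g \<in> S" shows "\<bar>N f - N g\<bar> \<le> N (\<lambda>x. f x - g x)"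
proof -
  have "N f \<le> N g + N (\<lambda>x. f x - g x)" "N g \<le> N f + N (\<lambda>x. f x - g x)"
    using assms norm_triangle_sub norm_triangle_sub[of "g _" "f _"]
    by (auto intro!: step_norm_dominated step_diff simp: norm_minus_commute)
  then show ?thesis by simp
qed

lemma step_norm_minus_commute:
  assumes "f \<in> S" "g \<in> S" shows "N (\<lambda>x. f x - g x) = N (\<lambda>x. g x - f x)"
  using assms by (intro antisym step_norm_mono step_diff) (simp_all add: norm_minus_commute)

lemma step_norm_convergent:
  assumes "s \<in> cauchy" shows "convergent (\<lambda>n. N (s n))"
proof (rule Cauchy_convergent, rule CauchyI)
  fix \<epsilon> :: real assume "\<epsilon> > 0"
  from cauchyE[OF assms this] obtain M
    where M: "\<And>m n. m \<ge> M \<Longrightarrow> n \<ge> M \<Longrightarrow> N (\<lambda>x. s m x - s n x) < \<epsilon>" by metis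
  have "norm (N (s m) - N (s n)) < \<epsilon>" if "m \<ge> M" "n \<ge> M" for m n
    using M[OF that] step_norm_diff_le[OF cauchy_step[OF assms] cauchy_step[OF assms], of m n] by simp
  then show "\<exists>M. \<forall>m\<ge>M. \<forall>n\<ge>M. norm (N (s m) - N (s n)) < \<epsilon>" by blast
qed

lemma step_equiv_iff:
  "(s, r) \<in> step_equiv R \<mu> \<longleftrightarrow>
     s \<in> cauchy \<and> r \<in> cauchy \<and> (\<lambda>n. N (\<lambda>x. s n x - r n x)) \<longlonglongrightarrow> 0"
  by (simp add: step_equiv_def)

lemma tendsto_zero_dominated:
  fixes a b :: "'b \<Rightarrow> real"
  assumes "(b \<longlongrightarrow> 0) F" "\<And>n. 0 \<le> a n" "\<And>n. a n \<le> b n" shows "(a \<longlongrightarrow> 0) F"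
  using assms by (intro tendsto_sandwich[OF _ _ tendsto_const assms(1)]) simp_all

lemma step_equiv_dominated:
  assumes "s \<in> cauchy" "r \<in> cauchy" "\<And>n. f n \<in> S" "\<And>n. g n \<in> S"
    and "(\<lambda>n. N (f n)) \<longlonglongrightarrow> 0" "(\<lambda>n. N (g n)) \<longlonglongrightarrow> 0"
    and "\<And>n x. cmod (s n x - r n x) \<le> cmod (f n x) + cmod (g n x)"
  shows "(s, r) \<in> step_equiv R \<mu>"
proof -
  have "(\<lambda>n. N (f n) + N (g n)) \<longlonglongrightarrow> 0" using tendsto_add[OF assms(5,6)] by simp
  then have "(\<lambda>n. N (\<lambda>x. s n x - r n x)) \<longlonglongrightarrow> 0"
  proof (rule tendsto_zero_dominated)
    fix n
    have d: "(\<lambda>x. s n x - r n x) \<in> S" by (intro step_diff cauchy_step assms(1,2))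
    show "0 \<le> N (\<lambda>x. s n x - r n x)" by (rule step_norm_nonneg[OF d])
    show "N (\<lambda>x. s n x - r n x) \<le> N (f n) + N (g n)"
      by (rule step_norm_dominated[OF d assms(3,4,7)])
  qed
  then show ?thesis using assms by (simp add: step_equiv_iff)
qed

lemma equiv_step_equiv: "equiv cauchy (step_equiv R \<mu>)"
proof (rule equivI)
  show "step_equiv R \<mu> \<subseteq> cauchy \<times> cauchy" by (auto simp: step_equiv_iff)
  show "refl_on cauchy (step_equiv R \<mu>)"
    by (auto simp: refl_on_def step_equiv_iff step_norm_zero)
  show "sym (step_equiv R \<mu>)"
  proof (rule symI)
    fix s r assume sr: "(s, r) \<in> step_equiv R \<mu>"
    then have "N (\<lambda>x. r n x - s n x) = N (\<lambda>x. s n x - r n x)" for n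
      by (intro step_norm_minus_commute cauchy_step) (simp_all add: step_equiv_iff)
    with sr show "(r, s) \<in> step_equiv R \<mu>" by (simp add: step_equiv_iff)
  qed
  show "trans (step_equiv R \<mu>)"
  proof (rule transI)
    fix s r q assume sr: "(s, r) \<in> step_equiv R \<mu>" and rq: "(r, q) \<in> step_equiv R \<mu>"
    have "cmod (s n x - q n x) \<le> cmod (s n x - r n x) + cmod (r n x - q n x)" for n x
      using norm_triangle_ineq[of "s n x - r n x" "r n x - q n x"] by simp
    then show "(s, q) \<in> step_equiv R \<mu>"
      using sr rq by (intro step_equiv_dominated[where f="\<lambda>n x. s n x - r n x" and g="\<lambda>n x. r n x - q n x"])
        (simp_all add: step_equiv_iff step_diff cauchy_step)
  qed
qed

lemma cls_eq_iff: "s \<in> cauchy \<Longrightarrow> r \<in> cauchy \<Longrightarrow> cls s = cls r \<longleftrightarrow> (s, r) \<in> step_equiv R \<mu>"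
  by (rule eq_equiv_class_iff[OF equiv_step_equiv])

lemma cls_in_H: "s \<in> cauchy \<Longrightarrow> cls s \<in> H"
  unfolding H_space_def by (rule quotientI)

lemma H_cases:
  assumes "u \<in> H" obtains s where "s \<in> cauchy" "u = cls s"
  using assms unfolding H_space_def by (elim quotientE)

lemma self_in_cls: "s \<in> cauchy \<Longrightarrow> s \<in> cls s"
  using equiv_class_self[OF equiv_step_equiv] .

text \<open>\<open>H_add\<close> is a union over all pairs of representatives; it is a single class
  because every pair contributes the same one.\<close>

lemma H_add_cls:
  assumes "s \<in> cauchy" "r \<in> cauchy"
  shows "H_add R \<mu> (cls s) (cls r) = cls (\<lambda>n x. s n x + r n x)"
proof -
  have "cls (\<lambda>n x. s' n x + r' n x) = cls (\<lambda>n x. s n x + r n x)" if "s' \<in> cls s" "r' \<in> cls r" for s' r'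
  proof -
    have c: "s' \<in> cauchy" "r' \<in> cauchy" "(\<lambda>n. N (\<lambda>x. s n x - s' n x)) \<longlonglongrightarrow> 0"
      "(\<lambda>n. N (\<lambda>x. r n x - r' n x)) \<longlonglongrightarrow> 0"
      using that by (simp_all add: step_equiv_iff)
    have "cmod (s n x + r n x - (s' n x + r' n x)) \<le> cmod (s n x - s' n x) + cmod (r n x - r' n x)" for n x
      by (simp add: add_diff_add norm_triangle_ineq)
    then have "(\<lambda>n x. s n x + r n x, \<lambda>n x. s' n x + r' n x) \<in> step_equiv R \<mu>"
      using assms c by (intro step_equiv_dominated[where f="\<lambda>n x. s n x - s' n x" and g="\<lambda>n x. r n x - r' n x"])
        (simp_all add: cauchy_add step_diff cauchy_step)
    then show ?thesis by (rule equiv_class_eq[OF equiv_step_equiv, symmetric])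
  qed
  then show ?thesis unfolding H_add_def
    using self_in_cls[OF assms(1)] self_in_cls[OF assms(2)] by blast
qed

lemma H_scale_cls:
  assumes "s \<in> cauchy"
  shows "H_scale R \<mu> c (cls s) = cls (\<lambda>n x. c * s n x)"
proof -
  have "cls (\<lambda>n x. c * s' n x) = cls (\<lambda>n x. c * s n x)" if "s' \<in> cls s" for s'
  proof -
    have c: "s' \<in> cauchy" "(\<lambda>n. N (\<lambda>x. s n x - s' n x)) \<longlonglongrightarrow> 0"
      using that by (simp_all add: step_equiv_iff)
    have "(\<lambda>n. N (\<lambda>x. c * (s n x - s' n x))) \<longlonglongrightarrow> 0"
      using tendsto_mult_right_zero[OF c(2), of "cmod c"] assms c
      by (simp add: step_norm_scale step_diff cauchy_step)
    then have "(\<lambda>n x. c * s n x, \<lambda>n x. c * s' n x) \<in> step_equiv R \<mu>"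
      using assms c(1) by (simp add: step_equiv_iff cauchy_scale right_diff_distrib)
    then show ?thesis by (rule equiv_class_eq[OF equiv_step_equiv, symmetric])
  qed
  then show ?thesis unfolding H_scale_def using self_in_cls[OF assms] by blast
qed

text \<open>Limits along two representatives agree, since their norms differ by at most the norm of
  the difference, a null sequence. This evaluates the definite description in
  \<open>H_norm\<close>.\<close>

lemma H_norm_cls:
  assumes s: "s \<in> cauchy" shows "(\<lambda>n. N (s n)) \<longlonglongrightarrow> H_norm R \<mu> (cls s)"
proof -
  obtain l where l: "(\<lambda>n. N (s n)) \<longlonglongrightarrow> l" using step_norm_convergent[OF s] by (auto simp: convergent_def)
  have "H_norm R \<mu> (cls s) = l" unfolding H_norm_def
  proof (rule the_equality)
    show "\<exists>s\<in>cls s. (\<lambda>n. N (s n)) \<longlonglongrightarrow> l" using l self_in_cls[OF s] by (rule bexI)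
    fix l' assume "\<exists>s\<in>cls s. (\<lambda>n. N (s n)) \<longlonglongrightarrow> l'"
    then obtain s' where s': "s' \<in> cls s" "(\<lambda>n. N (s' n)) \<longlonglongrightarrow> l'" by (elim bexE)
    have c: "s' \<in> cauchy" "(\<lambda>n. N (\<lambda>x. s n x - s' n x)) \<longlonglongrightarrow> 0"
      using s'(1) by (simp_all add: step_equiv_iff)
    have "(\<lambda>n. \<bar>N (s n) - N (s' n)\<bar>) \<longlonglongrightarrow> 0"
      by (rule tendsto_zero_dominated[OF c(2)])
        (simp_all add: step_norm_diff_le cauchy_step s c(1))
    then have "(\<lambda>n. N (s n) - N (s' n)) \<longlonglongrightarrow> 0" by (rule tendsto_rabs_zero_cancel)
    moreover have "(\<lambda>n. N (s n) - N (s' n)) \<longlonglongrightarrow> l - l'" by (rule tendsto_diff[OF l s'(2)])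
    ultimately have "l - l' = 0" using LIMSEQ_unique by blast
    then show "l' = l" by simp
  qed
  with l show ?thesis by simp
qed

lemma H_dist_cls:
  assumes "s \<in> cauchy" "r \<in> cauchy"
  shows "(\<lambda>n. N (\<lambda>x. s n x - r n x)) \<longlonglongrightarrow> H_dist R \<mu> (cls s) (cls r)"
  unfolding H_dist_def H_scale_cls[OF assms(2)] H_add_cls[OF assms(1) cauchy_scale[OF assms(2)]]
  using H_norm_cls[OF cauchy_diff[OF assms]] by simp

lemma H_dist_nonneg: "u \<in> H \<Longrightarrow> v \<in> H \<Longrightarrow> 0 \<le> H_dist R \<mu> u v"
  by (elim H_cases)
    (auto intro!: LIMSEQ_le_const[OF H_dist_cls] step_norm_nonneg step_diff cauchy_step)

lemma H_dist_triangle: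
  assumes "w \<in> H" "u \<in> H" "v \<in> H"
  shows "H_dist R \<mu> u v \<le> H_dist R \<mu> w u + H_dist R \<mu> w v"
proof -
  obtain q s r where q: "q \<in> cauchy" "w = cls q" and s: "s \<in> cauchy" "u = cls s"
    and r: "r \<in> cauchy" "v = cls r"
    using assms by (elim H_cases)
  have tri: "cmod (s n x - r n x) \<le> cmod (q n x - s n x) + cmod (q n x - r n x)" for n x
    using norm_triangle_ineq4[of "q n x - r n x" "q n x - s n x"] by simp
  have "N (\<lambda>x. s n x - r n x) \<le> N (\<lambda>x. q n x - s n x) + N (\<lambda>x. q n x - r n x)" for n
    by (rule step_norm_dominated) (simp_all add: tri step_diff cauchy_step q s r)
  then show ?thesis unfolding q s r
    by (intro LIMSEQ_le[OF H_dist_cls tendsto_add[OF H_dist_cls H_dist_cls]]) (use q s r in auto)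
qed

lemma H_dist_eq_0:
  assumes "u \<in> H" "v \<in> H" "H_dist R \<mu> u v = 0" shows "u = v"
proof -
  obtain s r where s: "s \<in> cauchy" "u = cls s" and r: "r \<in> cauchy" "v = cls r"
    using assms(1,2) by (elim H_cases)
  then show ?thesis
    using H_dist_cls[OF s(1) r(1)] assms(3) by (simp add: cls_eq_iff step_equiv_iff)
qed

text \<open>Serves to evaluate the definite description by which \<open>U_hat\<close> selects the
  strong limit.\<close>

lemma H_limit_unique:
  assumes "\<And>n. w n \<in> H" "u \<in> H" "v \<in> H"
    and "(\<lambda>n. H_dist R \<mu> (w n) u) \<longlonglongrightarrow> 0" "(\<lambda>n. H_dist R \<mu> (w n) v) \<longlonglongrightarrow> 0"
  shows "u = v"
proof (rule H_dist_eq_0[OF assms(2,3)])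
  have "(\<lambda>n::nat. H_dist R \<mu> u v) \<longlonglongrightarrow> 0"
    using tendsto_add[OF assms(4,5)] assms(1-3)
    by (rule_tac tendsto_zero_dominated) (auto intro: H_dist_nonneg H_dist_triangle)
  then show "H_dist R \<mu> u v = 0" by (simp add: LIMSEQ_const_iff)
qed

section \<open>Multiplication operators\<close>

text \<open>Step functions vanish off some ring set, so approximation is asked for on each ring set
  only; in general not even a nonzero constant is a uniform limit of step functions on the whole
  space.\<close>

definition approximable :: "('a \<Rightarrow> complex) \<Rightarrow> bool" where
  "approximable f \<longleftrightarrow> (\<forall>C\<in>R. \<forall>\<epsilon>>0. \<exists>g\<in>S. \<forall>x\<in>C. cmod (f x - g x) \<le> \<epsilon>)"

definition multiplier :: "('a \<Rightarrow> complex) \<Rightarrow> bool" where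
  "multiplier f \<longleftrightarrow> approximable f \<and> (\<forall>x. cmod (f x) \<le> 1)"

text \<open>The inner condition of \<open>H_mult\<close>, isolated so that products can be handled
  on representatives before passing to classes.\<close>

definition product_limit ::
    "('a \<Rightarrow> complex) \<Rightarrow> (nat \<Rightarrow> 'a \<Rightarrow> complex) \<Rightarrow> (nat \<Rightarrow> 'a \<Rightarrow> complex) \<Rightarrow> bool" where
  "product_limit f s r \<longleftrightarrow> (\<exists>g. (\<forall>n. g n \<in> S) \<and>
     (\<forall>n x. cmod (f x * s n x - r n x) \<le> cmod (g n x)) \<and> (\<lambda>n. N (g n)) \<longlonglongrightarrow> 0)"

lemma multiplier_le_1: "multiplier f \<Longrightarrow> cmod (f x) \<le> 1"
  by (simp add: multiplier_def)

lemma multiplier_mult_le: "multiplier f \<Longrightarrow> cmod (f x * z) \<le> cmod z"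
  by (simp add: norm_mult mult_left_le_one_le multiplier_le_1)

lemma norm_diff_add_le: "norm (a - b + c) \<le> norm a + norm b + norm c"
  for a b c :: "'b::real_normed_vector"
  using norm_triangle_ineq[of "a - b" c] norm_triangle_ineq4[of a b] by linarith

lemma approximableE:
  assumes "approximable f" "C \<in> R" "\<epsilon> > 0"
  obtains g where "g \<in> S" "\<And>x. x \<in> C \<Longrightarrow> cmod (f x - g x) \<le> \<epsilon>"
  using assms unfolding approximable_def by metis

lemma product_limitE:
  assumes "product_limit f s r"
  obtains g where "\<And>n. g n \<in> S" "\<And>n x. cmod (f x * s n x - r n x) \<le> cmod (g n x)"
    "(\<lambda>n. N (g n)) \<longlonglongrightarrow> 0"
  using assms unfolding product_limit_def by metis

lemma product_limitI:
  assumes "\<And>n. g n \<in> S" "\<And>n. h n \<in> S"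
    and "\<And>n x. cmod (f x * s n x - r n x) \<le> cmod (g n x) + cmod (h n x)"
    and "(\<lambda>n. N (g n)) \<longlonglongrightarrow> 0" "(\<lambda>n. N (h n)) \<longlonglongrightarrow> 0"
  shows "product_limit f s r"
  unfolding product_limit_def
proof (intro exI conjI allI)
  let ?G = "\<lambda>n x. complex_of_real (cmod (g n x)) + complex_of_real (cmod (h n x))"
  show G: "?G n \<in> S" for n by (intro step_abs_add assms)
  show "cmod (f x * s n x - r n x) \<le> cmod (?G n x)" for n x using assms(3) by simp
  have "(\<lambda>n. N (g n) + N (h n)) \<longlonglongrightarrow> 0" using tendsto_add[OF assms(4,5)] by simp
  then show "(\<lambda>n. N (?G n)) \<longlonglongrightarrow> 0"
    by (rule tendsto_zero_dominated) (intro step_norm_nonneg step_abs_add assms)+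
qed

text \<open>Off the support of \<open>s\<close> both products vanish, so approximating
  \<open>f\<close> on a ring set around the support is enough; the error is then dominated by
  \<open>\<delta>\<close> times \<open>s\<close>, itself a step function.\<close>

lemma approximate_product:
  assumes f: "approximable f" and s: "s \<in> S" and "\<eta> > 0"
  obtains r g where "r \<in> S" "g \<in> S" "\<And>x. cmod (f x * s x - r x) \<le> cmod (g x)" "N g \<le> \<eta>"
proof -
  obtain C where C: "C \<in> R" "\<And>x. x \<notin> C \<Longrightarrow> s x = 0" using step_support[OF s] by metis
  \<comment> \<open>The \<open>+ 1\<close> guards against \<open>N s = 0\<close>.\<close>
  define \<delta> where "\<delta> = \<eta> / (N s + 1)"
  have Ns: "0 \<le> N s" by (rule step_norm_nonneg[OF s])
  then have \<delta>: "\<delta> > 0" using assms(3) by (simp add: \<delta>_def)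
  obtain h where h: "h \<in> S" "\<And>x. x \<in> C \<Longrightarrow> cmod (f x - h x) \<le> \<delta>"
    using approximableE[OF f C(1) \<delta>] by metis
  show thesis
  proof (rule that)
    show "(\<lambda>x. h x * s x) \<in> S" by (rule step_mult[OF h(1) s])
    show "(\<lambda>x. complex_of_real \<delta> * s x) \<in> S" by (rule step_scale[OF s])
    show "cmod (f x * s x - h x * s x) \<le> cmod (complex_of_real \<delta> * s x)" for x
    proof (cases "x \<in> C")
      case True
      then have "cmod (f x - h x) * cmod (s x) \<le> \<delta> * cmod (s x)"
        using h(2) by (intro mult_right_mono) simp_all
      then show ?thesis using \<delta> by (simp add: norm_mult flip: left_diff_distrib)
    qed (simp add: C(2))
    have "\<delta> * N s \<le> \<delta> * (N s + 1)" using \<delta> by simp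
    also have "\<dots> = \<eta>" using Ns by (simp add: \<delta>_def)
    finally show "N (\<lambda>x. complex_of_real \<delta> * s x) \<le> \<eta>"
      using \<delta> by (simp add: step_norm_scale s)
  qed
qed

text \<open>Each \<open>s n\<close> is multiplied with its own tolerance \<open>1 / (n + 1)\<close>.
  Contractivity of \<open>f\<close> transfers the Cauchy property of \<open>s\<close>, up to two
  errors of vanishing norm.\<close>

lemma product_limit_exists:
  assumes f: "multiplier f" and s: "s \<in> cauchy"
  obtains r where "r \<in> cauchy" "product_limit f s r"
proof -
  have "\<exists>r g. r \<in> S \<and> g \<in> S \<and> (\<forall>x. cmod (f x * s n x - r x) \<le> cmod (g x)) \<and>
      N g \<le> inverse (real (Suc n))" for n
  proof -
    have "inverse (real (Suc n)) > 0" "approximable f" using f by (simp_all add: multiplier_def)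
    from approximate_product[OF this(2) cauchy_step[OF s] this(1)] show ?thesis by metis
  qed
  then obtain r g where r: "\<And>n. r n \<in> S" and g: "\<And>n. g n \<in> S"
    and d: "\<And>n x. cmod (f x * s n x - r n x) \<le> cmod (g n x)"
    and b: "\<And>n. N (g n) \<le> inverse (real (Suc n))"
    by metis
  have g0: "(\<lambda>n. N (g n)) \<longlonglongrightarrow> 0"
    by (rule tendsto_zero_dominated[OF LIMSEQ_inverse_real_of_nat]) (simp_all only: step_norm_nonneg g b)
  show thesis
  proof (rule that)
    show "product_limit f s r" unfolding product_limit_def using g d g0 by blast
    show "r \<in> cauchy"
    proof (rule cauchy_dominated[OF s cauchy_zero r g g0, where K=1])
      fix m n x
      have "r m x - r n x = f x * (s m x - s n x) - (f x * s m x - r m x) + (f x * s n x - r n x)"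
        by (simp add: algebra_simps)
      then have "cmod (r m x - r n x) \<le>
          cmod (f x * (s m x - s n x)) + cmod (f x * s m x - r m x) + cmod (f x * s n x - r n x)"
        by (simp only: norm_diff_add_le)
      then show "cmod (r m x - r n x) \<le>
          1 * cmod (s m x - s n x) + cmod (0 - 0) + (cmod (g m x) + cmod (g n x))"
        using d[of x m] d[of x n] multiplier_mult_le[OF f, of x "s m x - s n x"] by simp
    qed
  qed
qed

text \<open>Makes the product well defined on classes: subtracting the two relations leaves
  \<open>f\<close> times \<open>s n - s' n\<close>, which is contracted, and the two errors.\<close>

lemma product_limit_equiv:
  assumes f: "multiplier f" and c: "r \<in> cauchy" "r' \<in> cauchy"
    and ss: "(s, s') \<in> step_equiv R \<mu>" and r: "product_limit f s r" and r': "product_limit f s' r'"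
  shows "(r, r') \<in> step_equiv R \<mu>"
proof -
  have s: "s \<in> cauchy" "s' \<in> cauchy" "(\<lambda>n. N (\<lambda>x. s n x - s' n x)) \<longlonglongrightarrow> 0"
    using ss by (simp_all add: step_equiv_iff)
  obtain g where g: "\<And>n. g n \<in> S" "\<And>n x. cmod (f x * s n x - r n x) \<le> cmod (g n x)"
    "(\<lambda>n. N (g n)) \<longlonglongrightarrow> 0" using product_limitE[OF r] by metis
  obtain g' where g': "\<And>n. g' n \<in> S" "\<And>n x. cmod (f x * s' n x - r' n x) \<le> cmod (g' n x)"
    "(\<lambda>n. N (g' n)) \<longlonglongrightarrow> 0" using product_limitE[OF r'] by metis
  let ?G = "\<lambda>n x. complex_of_real (cmod (g n x)) + complex_of_real (cmod (g' n x))"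
  have G: "?G n \<in> S" for n by (intro step_abs_add g g')
  have "(\<lambda>n. N (g n) + N (g' n)) \<longlonglongrightarrow> 0" using tendsto_add[OF g(3) g'(3)] by simp
  then have G0: "(\<lambda>n. N (?G n)) \<longlonglongrightarrow> 0"
    by (rule tendsto_zero_dominated) (intro step_norm_nonneg step_abs_add g g')+
  show ?thesis
  proof (rule step_equiv_dominated[OF c _ G s(3) G0])
    show "(\<lambda>x. s n x - s' n x) \<in> S" for n by (intro step_diff cauchy_step s)
    fix n x
    have "r n x - r' n x = f x * (s n x - s' n x) - (f x * s n x - r n x) + (f x * s' n x - r' n x)"
      by (simp add: algebra_simps)
    then have "cmod (r n x - r' n x) \<le>
        cmod (f x * (s n x - s' n x)) + cmod (f x * s n x - r n x) + cmod (f x * s' n x - r' n x)"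
      by (simp only: norm_diff_add_le)
    then show "cmod (r n x - r' n x) \<le> cmod (s n x - s' n x) + cmod (?G n x)"
      using g(2)[of x n] g'(2)[of x n] multiplier_mult_le[OF f, of x "s n x - s' n x"] by simp
  qed
qed

lemma H_mult_cls:
  assumes f: "multiplier f" and c: "s \<in> cauchy" "r \<in> cauchy" and sr: "product_limit f s r"
  shows "H_mult R \<mu> f (cls s) = cls r"
  unfolding H_mult_def
proof (rule the_equality)
  show "cls r \<in> H \<and> (\<exists>s\<in>cls s. \<exists>r\<in>cls r. \<exists>g. (\<forall>n. g n \<in> S) \<and>
      (\<forall>n x. cmod (f x * s n x - r n x) \<le> cmod (g n x)) \<and> (\<lambda>n. N (g n)) \<longlonglongrightarrow> 0)"
    using cls_in_H[OF c(2)] self_in_cls[OF c(1)] self_in_cls[OF c(2)] sr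
    unfolding product_limit_def by (intro conjI bexI)
next
  fix v assume v: "v \<in> H \<and> (\<exists>s\<in>cls s. \<exists>r\<in>v. \<exists>g. (\<forall>n. g n \<in> S) \<and>
      (\<forall>n x. cmod (f x * s n x - r n x) \<le> cmod (g n x)) \<and> (\<lambda>n. N (g n)) \<longlonglongrightarrow> 0)"
  then obtain s' r' where *: "s' \<in> cls s" "r' \<in> v" "product_limit f s' r'"
    unfolding product_limit_def[symmetric] by (elim conjE bexE)
  \<comment> \<open>\<open>v\<close> is first known as the class of some \<open>q\<close>; changing
    the representative to \<open>r'\<close> puts the class and the product relation on the same
    sequence.\<close>
  obtain q where q: "q \<in> cauchy" "v = cls q" using v by (elim conjE H_cases)
  then have "(q, r') \<in> step_equiv R \<mu>" using * by simp
  then have r': "r' \<in> cauchy" and vr: "v = cls r'"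
    using equiv_class_eq[OF equiv_step_equiv] q by (auto simp: step_equiv_iff)
  have "(r, r') \<in> step_equiv R \<mu>"
    using * by (intro product_limit_equiv[OF f c(2) r' _ sr]) simp_all
  then show "v = cls r" unfolding vr by (rule equiv_class_eq[OF equiv_step_equiv, symmetric])
qed

lemma H_multE:
  assumes "multiplier f" "s \<in> cauchy"
  obtains r where "r \<in> cauchy" "product_limit f s r" "H_mult R \<mu> f (cls s) = cls r"
  using product_limit_exists[OF assms] H_mult_cls[OF assms] by metis

lemma H_mult_in_H: "multiplier f \<Longrightarrow> u \<in> H \<Longrightarrow> H_mult R \<mu> f u \<in> H"
  by (metis H_cases H_multE cls_in_H)

section \<open>Algebraic laws and contractivity of multiplication\<close>

lemma H_mult_add:
  assumes f: "multiplier f" and "u \<in> H" "v \<in> H"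
  shows "H_mult R \<mu> f (H_add R \<mu> u v) = H_add R \<mu> (H_mult R \<mu> f u) (H_mult R \<mu> f v)"
proof -
  obtain s s' where s: "s \<in> cauchy" "u = cls s" and s': "s' \<in> cauchy" "v = cls s'"
    using assms(2,3) by (elim H_cases)
  obtain r where r: "r \<in> cauchy" "product_limit f s r" "H_mult R \<mu> f (cls s) = cls r"
    by (rule H_multE[OF f s(1)])
  obtain r' where r': "r' \<in> cauchy" "product_limit f s' r'" "H_mult R \<mu> f (cls s') = cls r'"
    by (rule H_multE[OF f s'(1)])
  obtain g where g: "\<And>n. g n \<in> S" "\<And>n x. cmod (f x * s n x - r n x) \<le> cmod (g n x)"
    "(\<lambda>n. N (g n)) \<longlonglongrightarrow> 0" using product_limitE[OF r(2)] by metis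
  obtain g' where g': "\<And>n. g' n \<in> S" "\<And>n x. cmod (f x * s' n x - r' n x) \<le> cmod (g' n x)"
    "(\<lambda>n. N (g' n)) \<longlonglongrightarrow> 0" using product_limitE[OF r'(2)] by metis
  have "product_limit f (\<lambda>n x. s n x + s' n x) (\<lambda>n x. r n x + r' n x)"
  proof (rule product_limitI[OF g(1) g'(1) _ g(3) g'(3)])
    fix n x
    have "f x * (s n x + s' n x) - (r n x + r' n x) = (f x * s n x - r n x) + (f x * s' n x - r' n x)"
      by (simp add: algebra_simps)
    also have "cmod \<dots> \<le> cmod (f x * s n x - r n x) + cmod (f x * s' n x - r' n x)"
      by (rule norm_triangle_ineq)
    finally show "cmod (f x * (s n x + s' n x) - (r n x + r' n x)) \<le> cmod (g n x) + cmod (g' n x)"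
      using g(2)[of x n] g'(2)[of x n] by simp
  qed
  from H_mult_cls[OF f cauchy_add[OF s(1) s'(1)] cauchy_add[OF r(1) r'(1)] this]
  show ?thesis unfolding s s' r(3) r'(3) H_add_cls[OF s(1) s'(1)] H_add_cls[OF r(1) r'(1)] .
qed

lemma H_mult_scale:
  assumes f: "multiplier f" and "u \<in> H"
  shows "H_mult R \<mu> f (H_scale R \<mu> c u) = H_scale R \<mu> c (H_mult R \<mu> f u)"
proof -
  obtain s where s: "s \<in> cauchy" "u = cls s" using assms(2) by (elim H_cases)
  obtain r where r: "r \<in> cauchy" "product_limit f s r" "H_mult R \<mu> f (cls s) = cls r"
    by (rule H_multE[OF f s(1)])
  obtain g where g: "\<And>n. g n \<in> S" "\<And>n x. cmod (f x * s n x - r n x) \<le> cmod (g n x)"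
    "(\<lambda>n. N (g n)) \<longlonglongrightarrow> 0" using product_limitE[OF r(2)] by metis
  have "product_limit f (\<lambda>n x. c * s n x) (\<lambda>n x. c * r n x)"
    unfolding product_limit_def
  proof (intro exI conjI allI)
    show "(\<lambda>x. c * g n x) \<in> S" for n by (intro step_scale g)
    show "cmod (f x * (c * s n x) - c * r n x) \<le> cmod (c * g n x)" for n x
    proof -
      have "f x * (c * s n x) - c * r n x = c * (f x * s n x - r n x)" by (simp add: algebra_simps)
      then show ?thesis by (simp add: norm_mult mult_left_mono g(2))
    qed
    show "(\<lambda>n. N (\<lambda>x. c * g n x)) \<longlonglongrightarrow> 0"
      using tendsto_mult_right_zero[OF g(3), of "cmod c"] by (simp add: step_norm_scale g(1))
  qed
  from H_mult_cls[OF f cauchy_scale[OF s(1)] cauchy_scale[OF r(1)] this]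
  show ?thesis unfolding s r(3) H_scale_cls[OF s(1)] H_scale_cls[OF r(1)] .
qed

text \<open>The error made in multiplying by \<open>g\<close> is multiplied by \<open>f\<close>,
  which does not enlarge it, and joined to the error made by \<open>f\<close>; so \<open>q\<close>
  represents both sides.\<close>

lemma H_mult_mult:
  assumes f: "multiplier f" and g: "multiplier g" and fg: "multiplier (\<lambda>x. f x * g x)" and "u \<in> H"
  shows "H_mult R \<mu> (\<lambda>x. f x * g x) u = H_mult R \<mu> f (H_mult R \<mu> g u)"
proof -
  obtain s where s: "s \<in> cauchy" "u = cls s" using assms(4) by (elim H_cases)
  obtain r where r: "r \<in> cauchy" "product_limit g s r" "H_mult R \<mu> g (cls s) = cls r"
    by (rule H_multE[OF g s(1)])
  obtain q where q: "q \<in> cauchy" "product_limit f r q" "H_mult R \<mu> f (cls r) = cls q"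
    by (rule H_multE[OF f r(1)])
  obtain h where h: "\<And>n. h n \<in> S" "\<And>n x. cmod (g x * s n x - r n x) \<le> cmod (h n x)"
    "(\<lambda>n. N (h n)) \<longlonglongrightarrow> 0" using product_limitE[OF r(2)] by metis
  obtain k where k: "\<And>n. k n \<in> S" "\<And>n x. cmod (f x * r n x - q n x) \<le> cmod (k n x)"
    "(\<lambda>n. N (k n)) \<longlonglongrightarrow> 0" using product_limitE[OF q(2)] by metis
  have "product_limit (\<lambda>x. f x * g x) s q"
  proof (rule product_limitI[OF h(1) k(1) _ h(3) k(3)])
    fix n x
    have "f x * g x * s n x - q n x = f x * (g x * s n x - r n x) + (f x * r n x - q n x)"
      by (simp add: algebra_simps)
    also have "cmod \<dots> \<le> cmod (f x * (g x * s n x - r n x)) + cmod (f x * r n x - q n x)"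
      by (rule norm_triangle_ineq)
    finally show "cmod (f x * g x * s n x - q n x) \<le> cmod (h n x) + cmod (k n x)"
      using h(2)[of x n] k(2)[of x n] multiplier_mult_le[OF f, of x "g x * s n x - r n x"] by simp
  qed
  from H_mult_cls[OF fg s(1) q(1) this] show ?thesis unfolding s r(3) q(3) .
qed

lemma H_mult_one:
  assumes "multiplier (\<lambda>x. 1)" "u \<in> H" shows "H_mult R \<mu> (\<lambda>x. 1) u = u"
proof -
  obtain s where s: "s \<in> cauchy" "u = cls s" using assms(2) by (elim H_cases)
  have "product_limit (\<lambda>x. 1) s s" unfolding product_limit_def
    by (rule exI[of _ "\<lambda>n x. 0"]) (simp add: step_zero step_norm_zero)
  from H_mult_cls[OF assms(1) s(1) s(1) this] show ?thesis unfolding s .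
qed

lemma H_mult_norm_le:
  assumes f: "multiplier f" and "u \<in> H" shows "H_norm R \<mu> (H_mult R \<mu> f u) \<le> H_norm R \<mu> u"
proof -
  obtain s where s: "s \<in> cauchy" "u = cls s" using assms(2) by (elim H_cases)
  obtain r where r: "r \<in> cauchy" "product_limit f s r" "H_mult R \<mu> f (cls s) = cls r"
    by (rule H_multE[OF f s(1)])
  obtain g where g: "\<And>n. g n \<in> S" "\<And>n x. cmod (f x * s n x - r n x) \<le> cmod (g n x)"
    "(\<lambda>n. N (g n)) \<longlonglongrightarrow> 0" using product_limitE[OF r(2)] by metis
  have le: "N (r n) \<le> N (s n) + N (g n)" for n
  proof (rule step_norm_dominated)
    fix x
    have "cmod (r n x) \<le> cmod (f x * s n x) + cmod (f x * s n x - r n x)"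
      using norm_triangle_ineq4[of "f x * s n x" "f x * s n x - r n x"] by simp
    then show "cmod (r n x) \<le> cmod (s n x) + cmod (g n x)"
      using g(2)[of x n] multiplier_mult_le[OF f, of x "s n x"] by simp
  qed (intro cauchy_step r s g)+
  have "(\<lambda>n. N (s n) + N (g n)) \<longlonglongrightarrow> H_norm R \<mu> (cls s)"
    using tendsto_add[OF H_norm_cls[OF s(1)] g(3)] by simp
  from LIMSEQ_le[OF H_norm_cls[OF r(1)] this] le show ?thesis unfolding s r(3) by blast
qed

text \<open>Agreement with a multiplication is asked for on \<open>H\<close> only, since an operator
  given by a definite description, such as \<open>U_hat\<close>, is evaluated only there.\<close>

lemma H_mult_bounded_linear:
  assumes "multiplier f" "\<And>u. u \<in> H \<Longrightarrow> T u = H_mult R \<mu> f u"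
  shows "H_bounded_linear R \<mu> T"
proof -
  have add: "H_add R \<mu> u v \<in> H" if "u \<in> H" "v \<in> H" for u v
    using that by (elim H_cases) (simp add: H_add_cls cls_in_H cauchy_add)
  have scale: "H_scale R \<mu> c u \<in> H" if "u \<in> H" for c u
    using that by (elim H_cases) (simp add: H_scale_cls cls_in_H cauchy_scale)
  have "\<forall>u\<in>H. H_norm R \<mu> (T u) \<le> 1 * H_norm R \<mu> u"
    using assms by (simp add: H_mult_norm_le)
  then have "\<exists>K. \<forall>u\<in>H. H_norm R \<mu> (T u) \<le> K * H_norm R \<mu> u" ..
  then show ?thesis unfolding H_bounded_linear_def
    using assms(1) by (simp add: assms(2) add scale H_mult_in_H H_mult_add H_mult_scale)
qed

text \<open>An element of \<open>H\<close> is split into a step function, on whose support the multipliers are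
  uniformly close, and a small remainder, on which they are contractions.\<close>

lemma H_dist_mult_le:
  assumes f: "multiplier f" and f': "multiplier f'" and s: "s \<in> cauchy"
    and M: "\<And>n. n \<ge> M \<Longrightarrow> N (\<lambda>x. s n x - s M x) \<le> \<epsilon>"
    and d: "\<And>x. s M x \<noteq> 0 \<Longrightarrow> cmod (f x - f' x) \<le> \<delta>" and "\<delta> \<ge> 0"
  shows "H_dist R \<mu> (H_mult R \<mu> f (cls s)) (H_mult R \<mu> f' (cls s)) \<le> 2 * \<epsilon> + \<delta> * N (s M)"
proof -
  obtain r where r: "r \<in> cauchy" "product_limit f s r" "H_mult R \<mu> f (cls s) = cls r"
    by (rule H_multE[OF f s])
  obtain r' where r': "r' \<in> cauchy" "product_limit f' s r'" "H_mult R \<mu> f' (cls s) = cls r'"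
    by (rule H_multE[OF f' s])
  obtain g where g: "\<And>n. g n \<in> S" "\<And>n x. cmod (f x * s n x - r n x) \<le> cmod (g n x)"
    "(\<lambda>n. N (g n)) \<longlonglongrightarrow> 0" using product_limitE[OF r(2)] by metis
  obtain g' where g': "\<And>n. g' n \<in> S" "\<And>n x. cmod (f' x * s n x - r' n x) \<le> cmod (g' n x)"
    "(\<lambda>n. N (g' n)) \<longlonglongrightarrow> 0" using product_limitE[OF r'(2)] by metis
  have tri: "cmod (a + (b - c) + (p - q)) \<le> cmod a + (cmod b + cmod c) + (cmod p + cmod q)"
    for a b c p q
    using norm_triangle_ineq[of "a + (b - c)" "p - q"] norm_triangle_ineq[of a "b - c"]
      norm_triangle_ineq4[of b c] norm_triangle_ineq4[of p q] by linarith
  have le: "N (\<lambda>x. r n x - r' n x) \<le> 2 * \<epsilon> + \<delta> * N (s M) + (N (g n) + N (g' n))" if n: "n \<ge> M" for n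
  proof -
    let ?G = "\<lambda>x. complex_of_real (cmod (g n x)) + complex_of_real (cmod (g' n x))"
    note S = cauchy_step[OF s] cauchy_step[OF r(1)] cauchy_step[OF r'(1)] g(1) g'(1)
    have "N (\<lambda>x. r n x - r' n x) \<le>
        N (\<lambda>x. 2 * (s n x - s M x)) + N (\<lambda>x. complex_of_real \<delta> * s M x) + N ?G"
    proof (rule step_norm_dominated3)
      fix x
      \<comment> \<open>Each of the two multipliers meets the remainder \<open>s n - s M\<close>
        once, whence the factor 2 in front of \<open>\<epsilon>\<close>; the last group holds the
        errors of the two product limits, which vanish as \<open>n\<close> grows.\<close>
      have eq: "r n x - r' n x = (f x - f' x) * s M x + (f x * (s n x - s M x) - f' x * (s n x - s M x)) +
          ((f' x * s n x - r' n x) - (f x * s n x - r n x))"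
        by (simp add: algebra_simps)
      have "cmod (r n x - r' n x) \<le> cmod ((f x - f' x) * s M x) +
          (cmod (f x * (s n x - s M x)) + cmod (f' x * (s n x - s M x))) +
          (cmod (f' x * s n x - r' n x) + cmod (f x * s n x - r n x))"
        unfolding eq by (rule tri)
      moreover have "cmod ((f x - f' x) * s M x) \<le> \<delta> * cmod (s M x)"
      proof (cases "s M x = 0")
        case False
        then show ?thesis unfolding norm_mult by (intro mult_right_mono d) simp_all
      qed simp
      moreover have "cmod (2 * (s n x - s M x)) = 2 * cmod (s n x - s M x)"
        "cmod (complex_of_real \<delta> * s M x) = \<delta> * cmod (s M x)"
        using assms(6) by (simp_all only: norm_mult norm_numeral norm_of_real abs_of_nonneg)
      moreover note g(2)[of x n] g'(2)[of x n] multiplier_mult_le[OF f, of x "s n x - s M x"]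
        multiplier_mult_le[OF f', of x "s n x - s M x"]
      ultimately show "cmod (r n x - r' n x) \<le> cmod (2 * (s n x - s M x)) +
          cmod (complex_of_real \<delta> * s M x) + cmod (?G x)"
        unfolding cmod_abs_add by linarith
    qed (intro step_diff step_scale step_abs_add S)+
    also have "N (\<lambda>x. 2 * (s n x - s M x)) = 2 * N (\<lambda>x. s n x - s M x)"
      by (subst step_norm_scale) (simp_all add: step_diff S)
    also have "N (\<lambda>x. complex_of_real \<delta> * s M x) = \<delta> * N (s M)"
      using assms(6) by (simp add: step_norm_scale S)
    also have "N ?G \<le> N (g n) + N (g' n)" by (intro step_abs_add S)
    finally show ?thesis using M[OF n] by simp
  qed
  have "(\<lambda>n. 2 * \<epsilon> + \<delta> * N (s M) + (N (g n) + N (g' n))) \<longlonglongrightarrow> 2 * \<epsilon> + \<delta> * N (s M) + (0 + 0)"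
    by (intro tendsto_intros g(3) g'(3))
  from LIMSEQ_le[OF H_dist_cls[OF r(1) r'(1)] this] le show ?thesis unfolding r(3) r'(3) by auto
qed

text \<open>An arbitrary filter covers both the truncation limit and the limit in time; in the
  latter the multiplier property is known only for nonnegative times, hence the eventual
  hypothesis.\<close>

lemma H_mult_tendsto:
  fixes F :: "'i \<Rightarrow> 'a \<Rightarrow> complex"
  assumes f: "multiplier f" and F: "eventually (\<lambda>i. multiplier (F i)) Fl"
    and unif: "\<And>C \<delta>. C \<in> R \<Longrightarrow> \<delta> > 0 \<Longrightarrow> eventually (\<lambda>i. \<forall>x\<in>C. cmod (F i x - f x) \<le> \<delta>) Fl"
    and u: "u \<in> H"
  shows "((\<lambda>i. H_dist R \<mu> (H_mult R \<mu> (F i) u) (H_mult R \<mu> f u)) \<longlongrightarrow> 0) Fl"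
proof (rule tendstoI)
  fix e :: real assume e: "e > 0"
  obtain s where s: "s \<in> cauchy" "u = cls s" using u by (elim H_cases)
  \<comment> \<open>\<open>e / 8\<close> enters twice and \<open>\<delta> * N (s M)\<close> is at
    most \<open>e / 4\<close>, for a total of \<open>e / 2\<close>.\<close>
  have "e / 8 > 0" using e by simp
  from cauchyE[OF s(1) this] obtain M
    where M: "\<And>m n. m \<ge> M \<Longrightarrow> n \<ge> M \<Longrightarrow> N (\<lambda>x. s m x - s n x) < e / 8" by metis
  obtain C where C: "C \<in> R" "\<And>x. x \<notin> C \<Longrightarrow> s M x = 0" using step_support[OF cauchy_step[OF s(1)]] by metis
  define \<delta> where "\<delta> = e / (4 * (N (s M) + 1))"
  have Ns: "0 \<le> N (s M)" by (intro step_norm_nonneg cauchy_step s)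
  then have \<delta>: "\<delta> > 0" using e by (simp add: \<delta>_def)
  have "\<delta> * N (s M) \<le> \<delta> * (N (s M) + 1)" using \<delta> by simp
  also have "\<dots> = e / 4" using Ns by (simp add: \<delta>_def field_simps)
  finally have \<delta>N: "\<delta> * N (s M) \<le> e / 4" .
  from eventually_conj[OF F unif[OF C(1) \<delta>]]
  show "eventually (\<lambda>i. dist (H_dist R \<mu> (H_mult R \<mu> (F i) u) (H_mult R \<mu> f u)) 0 < e) Fl"
  proof (rule eventually_mono)
    fix i assume i: "multiplier (F i) \<and> (\<forall>x\<in>C. cmod (F i x - f x) \<le> \<delta>)"
    then have "H_dist R \<mu> (H_mult R \<mu> (F i) u) (H_mult R \<mu> f u) \<le> 2 * (e / 8) + \<delta> * N (s M)"
      unfolding s using M[of _ M] C(2) \<delta>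
      by (intro H_dist_mult_le) (auto intro: f s less_imp_le)
    moreover have "0 \<le> H_dist R \<mu> (H_mult R \<mu> (F i) u) (H_mult R \<mu> f u)"
      using i by (intro H_dist_nonneg H_mult_in_H f u) simp
    ultimately show "dist (H_dist R \<mu> (H_mult R \<mu> (F i) u) (H_mult R \<mu> f u)) 0 < e"
      using \<delta>N e by simp
  qed
qed

section \<open>Construction of multipliers\<close>

lemma approximable_limit:
  assumes F: "\<And>n::nat. approximable (F n)"
    and unif: "\<And>C \<delta>. C \<in> R \<Longrightarrow> \<delta> > 0 \<Longrightarrow> eventually (\<lambda>n. \<forall>x\<in>C. cmod (F n x - f x) \<le> \<delta>) sequentially"
  shows "approximable f"
  unfolding approximable_def
proof (intro ballI allI impI)
  fix C \<epsilon> assume C: "C \<in> R" and "(0::real) < \<epsilon>"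
  then have e: "\<epsilon> / 2 > 0" by simp
  from eventually_happens'[OF sequentially_bot unif[OF C e]] obtain n
    where n: "\<forall>x\<in>C. cmod (F n x - f x) \<le> \<epsilon> / 2" ..
  obtain g where g: "g \<in> S" "\<And>x. x \<in> C \<Longrightarrow> cmod (F n x - g x) \<le> \<epsilon> / 2"
    using approximableE[OF F C e] by metis
  have "cmod (f x - g x) \<le> \<epsilon>" if "x \<in> C" for x
    using norm_triangle_ineq4[of "F n x - g x" "F n x - f x"] n that g(2)[OF that] by fastforce
  with g(1) show "\<exists>g\<in>S. \<forall>x\<in>C. cmod (f x - g x) \<le> \<epsilon>" by blast
qed

lemma multiplier_mult:
  assumes f: "multiplier f" and g: "multiplier g" shows "multiplier (\<lambda>x. f x * g x)"
  unfolding multiplier_def approximable_def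
proof (intro conjI ballI allI impI)
  show "cmod (f x * g x) \<le> 1" for x
    using multiplier_mult_le[OF f, of x "g x"] multiplier_le_1[OF g, of x] by simp
  fix C \<epsilon> assume C: "C \<in> R" and "(0::real) < \<epsilon>"
  \<comment> \<open>The cap 1 bounds the approximant \<open>k\<close> by 2 on \<open>C\<close>, so
    the error is at most \<open>\<delta> + 2 * \<delta>\<close>; approximants of a multiplier may
    themselves exceed 1 in modulus.\<close>
  define \<delta> where "\<delta> = min 1 (\<epsilon> / 3)"
  have \<delta>: "\<delta> > 0" "\<delta> \<le> 1" "3 * \<delta> \<le> \<epsilon>" using \<open>0 < \<epsilon>\<close> by (auto simp: \<delta>_def)
  obtain h where h: "h \<in> S" "\<And>x. x \<in> C \<Longrightarrow> cmod (f x - h x) \<le> \<delta>"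
    using approximableE[of f, OF _ C \<delta>(1)] f unfolding multiplier_def by metis
  obtain k where k: "k \<in> S" "\<And>x. x \<in> C \<Longrightarrow> cmod (g x - k x) \<le> \<delta>"
    using approximableE[of g, OF _ C \<delta>(1)] g unfolding multiplier_def by metis
  have "cmod (f x * g x - h x * k x) \<le> \<epsilon>" if x: "x \<in> C" for x
  proof -
    have "cmod (k x) \<le> 2"
      using norm_triangle_ineq4[of "g x" "g x - k x"] k(2)[OF x] multiplier_le_1[OF g, of x] \<delta>
      by simp
    have "f x * g x - h x * k x = f x * (g x - k x) + (f x - h x) * k x"
      by (simp add: algebra_simps)
    also have "cmod \<dots> \<le> cmod (f x * (g x - k x)) + cmod ((f x - h x) * k x)"
      by (rule norm_triangle_ineq)
    finally have "cmod (f x * g x - h x * k x) \<le> cmod (f x * (g x - k x)) + cmod ((f x - h x) * k x)" .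
    moreover have "cmod ((f x - h x) * k x) \<le> \<delta> * 2"
      unfolding norm_mult using h(2)[OF x] \<open>cmod (k x) \<le> 2\<close> \<delta> by (intro mult_mono) simp_all
    ultimately show ?thesis
      using multiplier_mult_le[OF f, of x "g x - k x"] k(2)[OF x] \<delta>(3) by linarith
  qed
  then show "\<exists>g'\<in>S. \<forall>x\<in>C. cmod (f x * g x - g' x) \<le> \<epsilon>"
    using step_mult[OF h(1) k(1)] by (intro bexI[of _ "\<lambda>x. h x * k x"]) simp_all
qed

text \<open>Cut the range of \<open>y\<close> on \<open>C\<close> into half-open intervals as fine
  as uniform continuity of \<open>\<psi>\<close> demands and take the value at each left endpoint;
  the slabs of \<open>C\<close> over these intervals are ring sets.\<close>

lemma approximable_continuous_comp:
  fixes y :: "'a \<Rightarrow> real" and \<psi> :: "real \<Rightarrow> complex"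
  assumes bdd: "\<And>C. C \<in> R \<Longrightarrow> \<exists>K. \<forall>x\<in>C. \<bar>y x\<bar> \<le> K"
    and slab: "\<And>C p q. C \<in> R \<Longrightarrow> p < q \<Longrightarrow> C \<inter> {x. y x \<in> {p..<q}} \<in> R"
    and cont: "continuous_on UNIV \<psi>"
  shows "approximable (\<lambda>x. \<psi> (y x))"
  unfolding approximable_def
proof (intro ballI allI impI)
  fix C \<epsilon> assume C: "C \<in> R" and \<epsilon>: "(0::real) < \<epsilon>"
  obtain K where K: "\<And>x. x \<in> C \<Longrightarrow> \<bar>y x\<bar> \<le> K" using bdd[OF C] by metis
  have "uniformly_continuous_on {-K..K} \<psi>"
    by (intro compact_uniformly_continuous continuous_on_subset[OF cont]) auto
  then obtain \<delta> where \<delta>: "\<delta> > 0"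
    "\<And>v w. v \<in> {-K..K} \<Longrightarrow> w \<in> {-K..K} \<Longrightarrow> dist w v < \<delta> \<Longrightarrow> dist (\<psi> w) (\<psi> v) < \<epsilon>"
    unfolding uniformly_continuous_on_def using \<epsilon> by metis
  define a where "a i = - K + real i * \<delta>" for i
  \<comment> \<open>Strict, so that even the value \<open>K\<close> falls into one of the first
    \<open>m\<close> half-open intervals.\<close>
  obtain m where m: "2 * K < real m * \<delta>" using reals_Archimedean3[OF \<delta>(1)] by metis
  define A where "A i = C \<inter> {x. y x \<in> {a i..<a (Suc i)}}" for i
  define g where "g x = (\<Sum>i<m. \<psi> (a i) * indicator (A i) x)" for x
  have "A i \<in> R" for i
    unfolding A_def by (rule slab[OF C]) (simp add: a_def \<delta>(1))
  then have "g \<in> S" unfolding g_def[abs_def]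
    by (intro step_sum step_scale step_indicator R_subset_completion) simp_all
  moreover have "cmod (\<psi> (y x) - g x) \<le> \<epsilon>" if x: "x \<in> C" for x
  proof -
    let ?z = "(y x + K) / \<delta>"
    define i where "i = nat \<lfloor>?z\<rfloor>"
    have z: "0 \<le> ?z" using K[OF x] \<delta>(1) by (simp add: abs_le_iff)
    have i: "real i \<le> ?z" "?z < real i + 1"
      unfolding i_def using z by (simp_all add: of_nat_nat)
    have ai: "a i \<le> y x" "y x < a (Suc i)"
      using i \<delta>(1) by (simp_all add: a_def field_simps)
    have "real i * \<delta> < real m * \<delta>" using ai(1) K[OF x] m by (simp add: a_def abs_le_iff)
    then have "i < m" using \<delta>(1) by simp
    have neq: "x \<notin> A j" if "j \<noteq> i" for j
    proof
      assume "x \<in> A j"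
      then have "a j < a (Suc i)" "a i < a (Suc j)" using ai by (auto simp: A_def)
      then have "real j < real (Suc i)" "real i < real (Suc j)" using \<delta>(1) by (simp_all add: a_def)
      then show False using that by simp
    qed
    have "g x = (\<Sum>j\<in>{i}. \<psi> (a j) * indicator (A j) x)"
      unfolding g_def using \<open>i < m\<close> neq by (intro sum.mono_neutral_right) auto
    also have "\<dots> = \<psi> (a i)" using x ai by (simp add: A_def)
    finally have "g x = \<psi> (a i)" .
    moreover have "dist (\<psi> (y x)) (\<psi> (a i)) < \<epsilon>"
    proof (rule \<delta>(2))
      show "y x \<in> {-K..K}" using K[OF x] by auto
      then show "a i \<in> {-K..K}" using ai(1) \<delta>(1) by (simp add: a_def)
      show "dist (y x) (a i) < \<delta>" using ai by (simp add: dist_real_def a_def algebra_simps)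
    qed
    ultimately show ?thesis by (simp add: dist_norm)
  qed
  ultimately show "\<exists>g\<in>S. \<forall>x\<in>C. cmod (\<psi> (y x) - g x) \<le> \<epsilon>" by blast
qed

end

section \<open>The ring of blocks\<close>

lemma ring_block_ring: "ring_of_sets UNIV (block_ring e)"
  unfolding block_ring_def by (rule hull_in) (auto simp: ring_of_sets_iff)

text \<open>The sets satisfying \<open>P\<close> form a ring containing the blocks, and the hull
  lies inside every such ring.\<close>

lemma block_ring_induct [consumes 1, case_names block empty Un Diff]:
  assumes "A \<in> block_ring e"
    and "\<And>a b. abs_measurable_block e a b \<Longrightarrow> P (block e a b)" "P {}"
    and "\<And>A B. P A \<Longrightarrow> P B \<Longrightarrow> P (A \<union> B)" "\<And>A B. P A \<Longrightarrow> P B \<Longrightarrow> P (A - B)"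
  shows "P A"
proof -
  have "block_ring e \<subseteq> Collect P"
    unfolding block_ring_def by (rule hull_minimal) (auto simp: ring_of_sets_iff assms(2-5))
  with assms(1) show ?thesis by blast
qed

lemma block_in_ring: "abs_measurable_block e a b \<Longrightarrow> block e a b \<in> block_ring e"
  unfolding block_ring_def by (rule hull_inc) blast

lemma block_ring_bounded:
  assumes "A \<in> block_ring e" shows "\<exists>K. \<forall>x\<in>A. \<forall>j. \<bar>x \<bullet> e j\<bar> \<le> K"
  using assms
proof (induction rule: block_ring_induct)
  case (block a b)
  then obtain K1 K2 where "\<And>j. \<bar>a j\<bar> \<le> K1" "\<And>j. \<bar>b j\<bar> \<le> K2"
    by (auto simp: abs_measurable_block_def block_bounds_def bounded_iff)
  then have "\<bar>x \<bullet> e j\<bar> \<le> max K1 K2" if "x \<in> block e a b" for x j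
    using that unfolding block_def abs_le_iff le_max_iff_disj
    by (smt (verit) atLeastLessThan_iff mem_Collect_eq)
  then show ?case by blast
next
  case (Un A B)
  then obtain K1 K2 where "\<And>x j. x \<in> A \<Longrightarrow> \<bar>x \<bullet> e j\<bar> \<le> K1" "\<And>x j. x \<in> B \<Longrightarrow> \<bar>x \<bullet> e j\<bar> \<le> K2"
    by metis
  then show ?case by (intro exI[of _ "max K1 K2"]) (auto simp: le_max_iff_disj)
qed auto

lemma bounded_range_fun_upd: "bounded (range a) \<Longrightarrow> bounded (range (a(k := v)))"
  by (rule bounded_subset[of "insert v (range a)"]) auto

text \<open>Intersecting with a slab commutes with union and difference, so only blocks matter,
  where it clips a single coordinate interval.\<close>

lemma block_ring_slab:
  assumes "A \<in> block_ring e" "p < q"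
  shows "A \<inter> {x. x \<bullet> e k \<in> {p..<q}} \<in> block_ring e"
  using assms(1)
proof (induction rule: block_ring_induct)
  case (block a b)
  interpret ring_of_sets UNIV "block_ring e" by (rule ring_block_ring)
  let ?a = "a(k := max (a k) p)" and ?b = "b(k := min (b k) q)"
  have eq: "block e a b \<inter> {x. x \<bullet> e k \<in> {p..<q}} = block e ?a ?b"
    by (auto simp: block_def split: if_splits)
  show ?case
  proof (cases "?a k < ?b k")
    case True
    have bb: "block_bounds a b" using block by (simp add: abs_measurable_block_def)
    have "block_bounds ?a ?b" unfolding block_bounds_def
    proof (intro conjI allI)
      show "bounded (range ?a)" "bounded (range ?b)"
        using bb by (intro bounded_range_fun_upd; simp add: block_bounds_def)+
      show "?a j < ?b j" for j using True bb by (cases "j = k") (simp_all add: block_bounds_def)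
    qed
    \<comment> \<open>One changed term does not affect summability. For an empty original block the
      sum may diverge, but then the clipped block is empty too.\<close>
    moreover have "block e ?a ?b = {} \<or> summable (\<lambda>j. max 0 (ln (?b j - ?a j)))"
    proof (cases "block e a b = {}")
      case True
      then show ?thesis unfolding eq[symmetric] by simp
    next
      case False
      then have "summable (\<lambda>j. max 0 (ln (b j - a j)))"
        using block by (simp add: abs_measurable_block_def)
      moreover have ev: "eventually (\<lambda>j. max 0 (ln (?b j - ?a j)) = max 0 (ln (b j - a j))) sequentially"
        using eventually_gt_at_top[of k] by eventually_elim simp
      ultimately show ?thesis using summable_cong[OF ev] by simp
    qed
    ultimately show ?thesis unfolding eq abs_measurable_block_def[symmetric]
      by (intro block_in_ring) (simp add: abs_measurable_block_def)
  next
    case False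
    \<comment> \<open>The clipped bounds are not admissible here, but the intersection is empty and
      so in the ring.\<close>
    then have "block e ?a ?b = {}" unfolding block_def by (auto dest!: spec[of _ k])
    then show ?thesis unfolding eq by simp
  qed
next
  case empty
  interpret ring_of_sets UNIV "block_ring e" by (rule ring_block_ring)
  show ?case by simp
next
  case (Un A B)
  then show ?case unfolding Int_Un_distrib2 by (rule ring_of_sets.Un[OF ring_block_ring])
next
  case (Diff A B)
  have "(A - B) \<inter> {x. x \<bullet> e k \<in> {p..<q}} =
      A \<inter> {x. x \<bullet> e k \<in> {p..<q}} - B \<inter> {x. x \<bullet> e k \<in> {p..<q}}" by blast
  with Diff show ?case by (simp only: ring_of_sets.Diff[OF ring_block_ring])
qed

section \<open>The Gaussian semigroup\<close>

lemma bessel_inequality: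
  fixes e :: "nat \<Rightarrow> 'a::real_inner"
  assumes e: "\<And>i j. e i \<bullet> e j = of_bool (i = j)"
  shows "L2_set (\<lambda>k. u \<bullet> e k) {..<n} \<le> norm u"
proof -
  let ?P = "\<Sum>k<n. (u \<bullet> e k) *\<^sub>R e k"
  let ?s = "\<Sum>k<n. (u \<bullet> e k)\<^sup>2"
  have 1: "u \<bullet> ?P = ?s" by (simp add: inner_sum_right power2_eq_square)
  have "e k \<bullet> ?P = u \<bullet> e k" if "k < n" for k
    using that by (simp add: inner_sum_right e if_distrib[of "\<lambda>x. _ * x"] of_bool_def cong: if_cong)
  then have 2: "?P \<bullet> ?P = ?s"
    by (subst inner_sum_left) (simp add: power2_eq_square)
  have "0 \<le> (u - ?P) \<bullet> (u - ?P)" by (rule inner_ge_zero)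
  also have "\<dots> = u \<bullet> u - ?s"
    using 1 2 by (simp add: inner_diff_left inner_diff_right inner_commute)
  finally have "?s \<le> (norm u)\<^sup>2" by (simp add: power2_norm_eq_inner)
  then show ?thesis unfolding L2_set_def by (simp add: real_le_lsqrt)
qed

text \<open>The trace is bounded by the nuclear sum: in a partial trace the finite sum over
  \<open>k\<close> is taken inside the series over \<open>n\<close>, and Cauchy-Schwarz with Bessel
  bounds each term by \<open>norm (u n) * norm (v n)\<close>, independently of
  \<open>m\<close>.\<close>

lemma nuclear_diagonal_summable:
  fixes e :: "nat \<Rightarrow> 'a::{real_inner,banach}"
  assumes e: "\<And>i j. e i \<bullet> e j = of_bool (i = j)" and T: "nuclear_operator T"
    and nonneg: "\<And>k. 0 \<le> T (e k) \<bullet> e k"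
  shows "summable (\<lambda>k. T (e k) \<bullet> e k)"
proof -
  obtain u v where uv: "summable (\<lambda>n. norm (u n) * norm (v n))"
    "\<And>x. (\<lambda>n. (x \<bullet> u n) *\<^sub>R v n) sums T x"
    using T by (auto simp: nuclear_operator_def)
  show ?thesis
  proof (rule summableI_nonneg_bounded)
    fix m
    have "(\<lambda>n. (e k \<bullet> u n) * (v n \<bullet> e k)) sums (T (e k) \<bullet> e k)" for k
      using bounded_linear.sums[OF bounded_linear_inner_left uv(2), of "e k" "e k"] by simp
    then have sums: "(\<lambda>n. \<Sum>k<m. (e k \<bullet> u n) * (v n \<bullet> e k)) sums (\<Sum>k<m. T (e k) \<bullet> e k)"
      by (intro sums_sum) simp
    have "(\<Sum>k<m. (e k \<bullet> u n) * (v n \<bullet> e k)) \<le> norm (u n) * norm (v n)" for n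
    proof -
      have "(\<Sum>k<m. (e k \<bullet> u n) * (v n \<bullet> e k)) \<le> (\<Sum>k<m. \<bar>u n \<bullet> e k\<bar> * \<bar>v n \<bullet> e k\<bar>)"
        by (intro sum_mono) (simp add: inner_commute flip: abs_mult)
      also have "\<dots> \<le> L2_set (\<lambda>k. u n \<bullet> e k) {..<m} * L2_set (\<lambda>k. v n \<bullet> e k) {..<m}"
        by (rule L2_set_mult_ineq)
      also have "\<dots> \<le> norm (u n) * norm (v n)"
        by (intro mult_mono bessel_inequality e L2_set_nonneg norm_ge_zero)
      finally show ?thesis .
    qed
    then show "(\<Sum>k<m. T (e k) \<bullet> e k) \<le> (\<Sum>n. norm (u n) * norm (v n))"
      using sums uv(1) by (intro sums_le[OF _ sums summable_sums])
  qed (rule nonneg)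
qed

lemma abs_exp_minus_diff_le:
  fixes a b :: real
  assumes "0 \<le> a" "0 \<le> b" shows "\<bar>exp (- a) - exp (- b)\<bar> \<le> \<bar>a - b\<bar>"
proof -
  have *: "exp (- x) - exp (- y) \<le> y - x \<and> 0 \<le> exp (- x) - exp (- y)"
    if "0 \<le> x" "x \<le> y" for x y :: real
  proof -
    have "exp (- x) - exp (- y) = exp (- x) * (1 - exp (- (y - x)))"
      by (simp add: algebra_simps flip: exp_add)
    also have "\<dots> \<le> 1 * (1 - exp (- (y - x)))" using that by (intro mult_right_mono) simp_all
    also have "\<dots> \<le> y - x"
      using exp_ge_add_one_self[of "- (y - x)"] unfolding mult_1_left by linarith
    finally show ?thesis using that by simp
  qed
  show ?thesis using *[of a b] *[of b a] assms by (cases "a \<le> b") auto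
qed

lemma cmod_exp_diff_le:
  fixes a b t r :: real
  assumes "0 \<le> a" "0 \<le> b" "0 \<le> t" "0 \<le> r"
  shows "cmod (complex_of_real (exp (- (t / 2) * a)) - complex_of_real (exp (- (r / 2) * b)))
    \<le> \<bar>t / 2 * a - r / 2 * b\<bar>"
  using abs_exp_minus_diff_le[of "t / 2 * a" "r / 2 * b"] assms by (simp flip: of_real_diff)

text \<open>The bound sees \<open>y\<close> only through \<open>K\<close>, so it is uniform over all
  points whose coordinates share that bound.\<close>

lemma suminf_weighted_tail_le:
  fixes d y :: "nat \<Rightarrow> real"
  assumes d: "summable d" "\<And>k. 0 \<le> d k" and y: "\<And>k. \<bar>y k\<bar> \<le> K"
  shows "summable (\<lambda>k. d k * (y k)\<^sup>2)"
    and "\<bar>(\<Sum>k<n. d k * (y k)\<^sup>2) - (\<Sum>k. d k * (y k)\<^sup>2)\<bar> \<le> K\<^sup>2 * (suminf d - sum d {..<n})"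
proof -
  have y2: "(y k)\<^sup>2 \<le> K\<^sup>2" for k using y[of k] abs_le_square_iff[of "y k" K] by simp
  have le: "d k * (y k)\<^sup>2 \<le> d k * K\<^sup>2" for k using d(2) y2 by (intro mult_left_mono)
  have sK: "summable (\<lambda>k. d k * K\<^sup>2)" using d(1) by (rule summable_mult2)
  show s: "summable (\<lambda>k. d k * (y k)\<^sup>2)"
    by (rule summable_comparison_test'[OF sK, of 0]) (simp add: le d(2))
  have "(\<Sum>k. d k * (y k)\<^sup>2) - (\<Sum>k<n. d k * (y k)\<^sup>2) = (\<Sum>k. d (k + n) * (y (k + n))\<^sup>2)"
    using suminf_minus_initial_segment[OF s, of n] by simp
  moreover have "0 \<le> (\<Sum>k. d (k + n) * (y (k + n))\<^sup>2)"
    using s d(2) by (intro suminf_nonneg) (simp_all add: summable_iff_shift[of "\<lambda>k. d k * (y k)\<^sup>2"])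
  moreover have "(\<Sum>k. d (k + n) * (y (k + n))\<^sup>2) \<le> (\<Sum>k. d (k + n) * K\<^sup>2)"
    using s sK le by (intro suminf_le)
      (simp_all add: summable_iff_shift[of "\<lambda>k. d k * (y k)\<^sup>2"] summable_iff_shift[of "\<lambda>k. d k * K\<^sup>2"])
  moreover have "(\<Sum>k. d (k + n) * K\<^sup>2) = K\<^sup>2 * (suminf d - sum d {..<n})"
    using suminf_mult2[of "\<lambda>k. d (k + n)" "K\<^sup>2"] d(1) suminf_minus_initial_segment[OF d(1), of n]
    by (simp add: summable_iff_shift mult.commute)
  ultimately show "\<bar>(\<Sum>k<n. d k * (y k)\<^sup>2) - (\<Sum>k. d k * (y k)\<^sup>2)\<bar> \<le> K\<^sup>2 * (suminf d - sum d {..<n})"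
    by simp
qed

theorem corollary5p2:
  fixes e :: "nat \<Rightarrow> 'a::{real_inner,banach}"
    and \<mu> :: "'a set \<Rightarrow> real"
    and D :: "'a \<Rightarrow> 'a"
    and d :: "nat \<Rightarrow> real"
  assumes "orthonormal_basis e"
    and "is_block_measure e \<mu>"
    and "nuclear_operator D"
    and "selfadjoint_operator D"
    and "positive_definite_operator D"
    and "\<And>k. D (e k) = d k *\<^sub>R e k"
    and "nuclear_operator (sqrt_operator D)"
  shows "(\<forall>t\<ge>0. H_strong_limit (block_ring e) \<mu> (\<lambda>N. U_trunc e \<mu> d N t) (U_hat e \<mu> d t)) \<and>
         H_strongly_continuous_semigroup (block_ring e) \<mu> (U_hat e \<mu> d)"
proof -
  interpret ring_of_sets UNIV "block_ring e" by (rule ring_block_ring)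
  interpret content_ring "block_ring e" \<mu>
    by unfold_locales (use assms(2) in \<open>auto simp: is_block_measure_def\<close>)
  have e: "e i \<bullet> e j = of_bool (i = j)" for i j
    using assms(1) by (simp add: orthonormal_basis_def)
  have de: "D (e k) \<bullet> e k = d k" for k by (simp add: assms(6) e)
  have d: "0 \<le> d k" for k
  proof -
    have "e k \<noteq> 0" using e[of k k] by auto
    then show ?thesis using assms(5) de[of k] unfolding positive_definite_operator_def
      by (metis less_imp_le)
  qed
  have sd: "summable d"
    using nuclear_diagonal_summable[OF e assms(3)] by (simp add: de d)
  \<comment> \<open>The quadratic form of \<open>D\<close> in the eigenbasis. It converges at every
    single \<open>x\<close> because coordinates are bounded by \<open>norm x\<close>; uniform
    statements use the bound of a ring set instead.\<close>
  define q where "q x = (\<Sum>k. d k * (x \<bullet> e k)\<^sup>2)" for x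
  define f where "f t x = complex_of_real (exp (- (t / 2) * q x))" for t x
  define F where "F N t x = complex_of_real (exp (- (t / 2) * (\<Sum>k\<le>N. d k * (x \<bullet> e k)\<^sup>2)))" for N t x
  \<comment> \<open>The part of the trace beyond the truncation; \<open>Suc N\<close> because the
    truncated sum includes the index \<open>N\<close>.\<close>
  define \<rho> where "\<rho> N = suminf d - sum d {..<Suc N}" for N
  have \<rho>: "\<rho> \<longlonglongrightarrow> 0"
  proof -
    have "(\<lambda>N. sum d {..<Suc N}) \<longlonglongrightarrow> suminf d"
      using summable_LIMSEQ[OF sd] by (rule LIMSEQ_Suc)
    from tendsto_diff[OF tendsto_const this, of "suminf d"] show ?thesis by (simp add: \<rho>_def[abs_def])
  qed
  have ce: "\<bar>x \<bullet> e k\<bar> \<le> norm x" for x k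
    using Cauchy_Schwarz_ineq2[of x "e k"] e[of k k] by (simp add: norm_eq_sqrt_inner[of "e k"])
  have q0: "0 \<le> q x" for x
    unfolding q_def using suminf_weighted_tail_le(1)[OF sd d ce] by (intro suminf_nonneg) (simp_all add: d)
  have sum0: "0 \<le> (\<Sum>k\<le>N. d k * (x \<bullet> e k)\<^sup>2)" for N x by (intro sum_nonneg) (simp add: d)
  have tail: "\<bar>(\<Sum>k\<le>N. d k * (x \<bullet> e k)\<^sup>2) - q x\<bar> \<le> K\<^sup>2 * \<rho> N" if "\<And>j. \<bar>x \<bullet> e j\<bar> \<le> K" for x K N
    using suminf_weighted_tail_le(2)[OF sd d that, where n="Suc N"]
    unfolding q_def \<rho>_def by (simp only: lessThan_Suc_atMost)
  have coord: "multiplier (\<lambda>x. complex_of_real (exp (- (t / 2) * (d k * (x \<bullet> e k)\<^sup>2))))" if "0 \<le> t" for t k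
  proof -
    have "approximable (\<lambda>x. complex_of_real (exp (- (t / 2) * (d k * (x \<bullet> e k)\<^sup>2))))"
    proof (rule approximable_continuous_comp[where y="\<lambda>x. x \<bullet> e k" and
          \<psi>="\<lambda>y. complex_of_real (exp (- (t / 2) * (d k * y\<^sup>2)))"])
      show "\<exists>K. \<forall>x\<in>C. \<bar>x \<bullet> e k\<bar> \<le> K" if "C \<in> block_ring e" for C
        using block_ring_bounded[OF that] by blast
      show "C \<inter> {x. x \<bullet> e k \<in> {p..<q}} \<in> block_ring e" if "C \<in> block_ring e" "p < q" for C p q
        by (rule block_ring_slab[OF that])
    qed (intro continuous_intros)
    then show ?thesis using that d by (simp add: multiplier_def)
  qed
  \<comment> \<open>The exponential turns the sum into a finite product of multipliers, each
    depending continuously on one coordinate.\<close>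
  have multF: "multiplier (F N t)" if "0 \<le> t" for N t
  proof (induction N)
    case 0 show ?case using coord[OF that, of 0] by (simp add: F_def[abs_def])
  next
    case (Suc N)
    have "F (Suc N) t = (\<lambda>x. F N t x * complex_of_real (exp (- (t / 2) * (d (Suc N) * (x \<bullet> e (Suc N))\<^sup>2))))"
      by (rule ext) (simp add: F_def distrib_left flip: exp_add of_real_mult)
    then show ?case using multiplier_mult[OF Suc coord[OF that]] by simp
  qed
  have unif: "eventually (\<lambda>N. \<forall>x\<in>C. cmod (F N t x - f t x) \<le> \<delta>) sequentially"
    if C: "C \<in> block_ring e" and "\<delta> > 0" and t: "0 \<le> t" for C \<delta> t
  proof -
    obtain K where K: "\<And>x j. x \<in> C \<Longrightarrow> \<bar>x \<bullet> e j\<bar> \<le> K" using block_ring_bounded[OF C] by metis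
    have "(\<lambda>N. t / 2 * (K\<^sup>2 * \<rho> N)) \<longlonglongrightarrow> t / 2 * (K\<^sup>2 * 0)" by (intro tendsto_intros \<rho>)
    then have "eventually (\<lambda>N. t / 2 * (K\<^sup>2 * \<rho> N) < \<delta>) sequentially"
      using \<open>\<delta> > 0\<close> by (intro order_tendstoD(2)) simp_all
    then show ?thesis
    proof (rule eventually_mono, intro ballI)
      fix N x assume N: "t / 2 * (K\<^sup>2 * \<rho> N) < \<delta>" and x: "x \<in> C"
      have "cmod (F N t x - f t x) \<le> \<bar>t / 2 * (\<Sum>k\<le>N. d k * (x \<bullet> e k)\<^sup>2) - t / 2 * q x\<bar>"
        unfolding F_def f_def by (rule cmod_exp_diff_le[OF sum0 q0 t t])
      also have "\<dots> = t / 2 * \<bar>(\<Sum>k\<le>N. d k * (x \<bullet> e k)\<^sup>2) - q x\<bar>"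
        unfolding right_diff_distrib[symmetric] abs_mult using t by simp
      also have "\<dots> \<le> t / 2 * (K\<^sup>2 * \<rho> N)" using t by (intro mult_left_mono tail K x) simp
      finally show "cmod (F N t x - f t x) \<le> \<delta>" using N by simp
    qed
  qed
  have multf: "multiplier (f t)" if "0 \<le> t" for t
    unfolding multiplier_def
  proof
    show "approximable (f t)"
      by (rule approximable_limit[OF _ unif[OF _ _ that]]) (use multF[OF that] in \<open>simp_all add: multiplier_def\<close>)
    show "\<forall>x. cmod (f t x) \<le> 1" using that q0 by (simp add: f_def)
  qed
  have trunc: "U_trunc e \<mu> d N t = H_mult (block_ring e) \<mu> (F N t)" for N t
    by (simp add: U_trunc_def F_def[abs_def])
  have lim: "(\<lambda>N. H_dist (block_ring e) \<mu> (U_trunc e \<mu> d N t u) (H_mult (block_ring e) \<mu> (f t) u)) \<longlonglongrightarrow> 0"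
    if "0 \<le> t" "u \<in> H" for t u
    unfolding trunc using that by (intro H_mult_tendsto multf unif) (simp_all add: multF)
  \<comment> \<open>Replaces the definite description by a concrete multiplication, on
    \<open>H\<close> and for \<open>t \<ge> 0\<close>; everything after rests on it.\<close>
  have hat: "U_hat e \<mu> d t u = H_mult (block_ring e) \<mu> (f t) u" if t: "0 \<le> t" and u: "u \<in> H" for t u
    unfolding U_hat_def
  proof (rule the_equality)
    show "H_mult (block_ring e) \<mu> (f t) u \<in> H \<and>
      (\<lambda>N. H_dist (block_ring e) \<mu> (U_trunc e \<mu> d N t u) (H_mult (block_ring e) \<mu> (f t) u)) \<longlonglongrightarrow> 0"
      by (intro conjI H_mult_in_H multf lim t u)
    fix v assume v: "v \<in> H \<and> (\<lambda>N. H_dist (block_ring e) \<mu> (U_trunc e \<mu> d N t u) v) \<longlonglongrightarrow> 0"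
    show "v = H_mult (block_ring e) \<mu> (f t) u"
    proof (rule H_limit_unique[OF _ _ _ _ lim[OF t u]])
      show "U_trunc e \<mu> d N t u \<in> H" for N unfolding trunc by (intro H_mult_in_H multF t u)
    qed (use v in \<open>auto intro: H_mult_in_H multf t u\<close>)
  qed
  have "H_strong_limit (block_ring e) \<mu> (\<lambda>N. U_trunc e \<mu> d N t) (U_hat e \<mu> d t)" if "0 \<le> t" for t
    unfolding H_strong_limit_def using that by (simp add: hat lim H_mult_in_H multf)
  moreover have "H_strongly_continuous_semigroup (block_ring e) \<mu> (U_hat e \<mu> d)"
    unfolding H_strongly_continuous_semigroup_def
  proof (intro conjI allI impI ballI)
    show "H_bounded_linear (block_ring e) \<mu> (U_hat e \<mu> d t)" if "0 \<le> t" for t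
      by (rule H_mult_bounded_linear[OF multf[OF that] hat[OF that]])
    have f0: "f 0 = (\<lambda>x. 1)" by (simp add: f_def[abs_def])
    show "U_hat e \<mu> d 0 u = u" if "u \<in> H" for u
      using that multf[of 0] by (simp add: hat f0 H_mult_one)
    show "U_hat e \<mu> d (s + t) u = U_hat e \<mu> d s (U_hat e \<mu> d t u)"
      if s: "0 \<le> s" and t: "0 \<le> t" and u: "u \<in> H" for s t u
    proof -
      have fst: "f (s + t) = (\<lambda>x. f s x * f t x)"
      proof
        fix x
        have "- ((s + t) / 2) * q x = - (s / 2) * q x + - (t / 2) * q x"
          by (simp add: field_simps)
        then show "f (s + t) x = f s x * f t x" unfolding f_def by (simp only: exp_add of_real_mult)
      qed
      have st: "0 \<le> s + t" using s t by simp
      have "H_mult (block_ring e) \<mu> (\<lambda>x. f s x * f t x) u =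
          H_mult (block_ring e) \<mu> (f s) (H_mult (block_ring e) \<mu> (f t) u)"
        by (rule H_mult_mult[OF multf[OF s] multf[OF t] _ u]) (use multf[OF st] in \<open>simp add: fst\<close>)
      then show ?thesis
        unfolding hat[OF st u] hat[OF t u] hat[OF s H_mult_in_H[OF multf[OF t] u]] fst .
    qed
    show "((\<lambda>s. H_dist (block_ring e) \<mu> (U_hat e \<mu> d s u) (U_hat e \<mu> d t u)) \<longlongrightarrow> 0) (at t within {0..})"
      if u: "u \<in> H" and t: "0 \<le> t" for u t
    proof -
      \<comment> \<open>Only for \<open>s \<ge> 0\<close> is \<open>f s\<close> bounded by 1 and
        \<open>hat\<close> available; at \<open>t = 0\<close> the limit is one-sided.\<close>
      have ev: "eventually (\<lambda>s. 0 \<le> s) (at t within {0..})"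
        by (auto simp: eventually_at_filter)
      have "((\<lambda>s. H_dist (block_ring e) \<mu> (H_mult (block_ring e) \<mu> (f s) u)
          (H_mult (block_ring e) \<mu> (f t) u)) \<longlongrightarrow> 0) (at t within {0..})"
      proof (rule H_mult_tendsto[OF multf[OF t] _ _ u])
        show "eventually (\<lambda>s. multiplier (f s)) (at t within {0..})"
          using ev by (rule eventually_mono) (rule multf)
        fix C \<delta> assume C: "C \<in> block_ring e" and \<delta>: "(0::real) < \<delta>"
        obtain K where K: "\<And>x j. x \<in> C \<Longrightarrow> \<bar>x \<bullet> e j\<bar> \<le> K" using block_ring_bounded[OF C] by metis
        \<comment> \<open>Equal to \<open>K\<^sup>2 * suminf d\<close>, written as first term plus
          tail so that \<open>tail\<close> at index 0 bounds \<open>q\<close> on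
          \<open>C\<close>.\<close>
        define B where "B = (\<Sum>k\<le>0. d k * K\<^sup>2) + K\<^sup>2 * \<rho> 0"
        have qB: "q x \<le> B" if "x \<in> C" for x
        proof -
          have "d 0 * (x \<bullet> e 0)\<^sup>2 \<le> d 0 * K\<^sup>2"
            using K[OF that, of 0] d[of 0] abs_le_square_iff[of "x \<bullet> e 0" K]
            by (intro mult_left_mono) simp_all
          then show ?thesis using tail[OF K[OF that], of 0] by (simp add: B_def)
        qed
        have "((\<lambda>s. \<bar>s - t\<bar> / 2 * B) \<longlongrightarrow> \<bar>t - t\<bar> / 2 * B) (at t within {0..})"
          by (intro tendsto_intros) simp
        then have "eventually (\<lambda>s. \<bar>s - t\<bar> / 2 * B < \<delta>) (at t within {0..})"
          using \<delta> by (intro order_tendstoD(2)) simp_all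
        from eventually_conj[OF ev this]
        show "eventually (\<lambda>s. \<forall>x\<in>C. cmod (f s x - f t x) \<le> \<delta>) (at t within {0..})"
        proof (rule eventually_mono, intro ballI)
          fix s x assume s: "0 \<le> s \<and> \<bar>s - t\<bar> / 2 * B < \<delta>" and x: "x \<in> C"
          have "cmod (f s x - f t x) \<le> \<bar>s / 2 * q x - t / 2 * q x\<bar>"
            unfolding f_def using s t by (intro cmod_exp_diff_le q0) simp_all
          also have "\<dots> = \<bar>s - t\<bar> / 2 * q x"
            unfolding left_diff_distrib[symmetric] diff_divide_distrib[symmetric] abs_mult using q0[of x] by simp
          also have "\<dots> \<le> \<bar>s - t\<bar> / 2 * B" by (intro mult_left_mono qB x) simp
          finally show "cmod (f s x - f t x) \<le> \<delta>" using s by simp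
        qed
      qed
      moreover have "eventually (\<lambda>s. H_dist (block_ring e) \<mu> (H_mult (block_ring e) \<mu> (f s) u)
          (H_mult (block_ring e) \<mu> (f t) u) = H_dist (block_ring e) \<mu> (U_hat e \<mu> d s u) (U_hat e \<mu> d t u))
          (at t within {0..})"
        using ev by (rule eventually_mono) (simp add: hat t u)
      ultimately show ?thesis by (rule Lim_transform_eventually)
    qed
  qed
  ultimately show ?thesis by blast
qed

end
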